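(* Let $\mathbb{K}\subset\mathbb{C}$ be a field, $I=\langle f_1,\dots,f_N\rangle\subset\mathbb{K}[x_1,\dots,x_n]$, and let $E=\{\alpha_0,\dots,\alpha_{\delta-1}\}\subset\mathbb{N}^n$ be a set of $\delta$ exponent vectors stable under subtraction, with $\alpha_0=0$ and $|\alpha_0|\le\cdots\le|\alpha_{\delta-1}|$. Let $o=|\alpha_{\delta-1}|$, let $I^{(E)}\subset\mathbb{K}[\mathbf{x},\mu]$ be the $E$-deflated ideal, and let $D$ be the number of variables $\mu$. Let $(\xi,\nu)\in\mathbb{C}^{n+D}$ be an isolated solution of $I^{(E)}$. Then $\xi$ is a root of $I$, and $(\xi,\nu)$ uniquely determines an orthogonal pair of primal-dual bases $B=\{(\mathbf{x}-\xi)^{\alpha_0},\dots,(\mathbf{x}-\xi)^{\alpha_{\delta-1}}\}$ and $\mathbf{\Lambda}=\{\Lambda_0,\dots,\Lambda_{\delta-1}\}$ (the coordinates $\nu_{\alpha_i,\alpha_k+\mathbf{e}_j}$ of $\nu$ being the corresponding coefficients of $\Lambda_i$). The pair $B,\mathbf{\Lambda}$ is an orthogonal primal-dual basis pair for $\mathbb{C}[\mathbf{x}]/Q$ and its dual, where $Q=I_\xi+\mathfrak{m}_\xi^{o+1}$, with $I_\xi$ the intersection of the primary components of $I$ contained in $\mathfrak{m}_\xi$.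
   Context: $\mathfrak{m}_\xi\subset\mathbb{C}[\mathbf{x}]$ is the maximal ideal at $\xi$; primary components of $I$ are those of the ideal generated by $I$ in $\mathbb{C}[\mathbf{x}]$. $\mathbf{e}_i$ is the $i$-th standard unit vector. Stable under subtraction: if $\alpha,\beta\in\mathbb{N}^n$, $\beta\le\alpha$ componentwise and $\alpha\in E$, then $\beta\in E$. $E$-deflated ideal. Let $\mu=(\mu_{\alpha_i,\alpha_k+\mathbf{e}_j}:\alpha_i,\alpha_k\in E,\ j=1,\dots,n,\ |\alpha_i|\ge|\alpha_k|+1,\ \alpha_k+\mathbf{e}_j\notin E)$ be new indeterminates, of cardinality $D\le n\delta(\delta-1)/2$. For $i=1,\dots,n$, the parametric multiplication matrix $\mathtt{M}_i(\mu)$ is the $\delta\times\delta$ matrix whose transpose, with rows and columns indexed by $0,\dots,\delta-1$, has entry in row $k$, column $l$ equal to: $1$ if $\alpha_l=\alpha_k+\mathbf{e}_i$; the variable $\mu_{\alpha_l,\alpha_k+\mathbf{e}_i}$ if $\alpha_k+\mathbf{e}_i\notin E$ and $|\alpha_l|\ge|\alpha_k|+1$; and $0$ otherwise. (These transposes are strictly upper triangular.) Put $\mathtt{M}(\mu)^\gamma=\mathtt{M}_1(\mu)^{\gamma_1}\cdots\mathtt{M}_n(\mu)^{\gamma_n}$ (in this order) and $$\mathcal{N}_{\mathbf{x},\mu}(p)=\sum_{\gamma\in\mathbb{N}^n}\frac{1}{\gamma!}\,\partial^\gamma(p)(\mathbf{x})\,\mathtt{M}(\mu)^\gamma[1]\in\mathbb{K}[\mathbf{x},\mu]^\delta,\qquad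 [1]=(1,0,\dots,0)^t .$$ The $E$-deflated ideal $I^{(E)}\subset\mathbb{K}[\mathbf{x},\mu]$ is the ideal generated by the entries of $\mathcal{N}_{\mathbf{x},\mu}(f_k)$, $k=1,\dots,N$, and of $\mathtt{M}_i(\mu)\mathtt{M}_j(\mu)-\mathtt{M}_j(\mu)\mathtt{M}_i(\mu)$, $i,j=1,\dots,n$. Orthogonal primal-dual basis pair for $\mathbb{C}[\mathbf{x}]/Q$. For $\beta\in\mathbb{N}^n$, $\partial_\xi^\beta(p)=\frac{\partial^{|\beta|}p}{\partial x_1^{\beta_1}\cdots\partial x_n^{\beta_n}}(\xi)$; $\mathbb{C}[\partial_\xi]$ is the space of finite linear combinations of the $\partial_\xi^\beta$, and $\operatorname{ord}(\Lambda)$ is the maximal $|\beta|$ such that $\partial_\xi^\beta$ occurs in $\Lambda$ with non-zero coefficient. Let $\mathscr{D}=Q^\perp\subset\mathbb{C}[\partial_\xi]$ be the functionals vanishing on $Q$, identified with the dual of $\mathbb{C}[\mathbf{x}]/Q$, and $\mathscr{D}_t$ its elements of order $\le t$. The conditions are: (1) $B=\{(\mathbf{x}-\xi)^{\alpha_0},\dots,(\mathbf{x}-\xi)^{\alpha_{\delta-1}}\}$ is a basis of $\mathbb{C}[\mathbf{x}]/Q$, $\alpha_0=0$, and $B$ is connected to $1$ (each $\alpha_k\neq 0$ in $E$ is $\alpha_j+\mathbf{e}_i$ for some $\alpha_j\in E$ and some $i$); (2) $\mathbf{\Lambda}$ is the basis of $\mathscr{D}$ dual to $B$, i.e. $\Lambda_i((\mathbf{x}-\xi)^{\alpha_j})=\delta_{ij}$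 (Kronecker delta), and it has the form $\Lambda_0=1_\xi$ (evaluation at $\xi$), $\Lambda_i=\frac{1}{\alpha_i!}\partial_\xi^{\alpha_i}+\sum_{|\beta|\le|\alpha_i|,\,\beta\notin E}\nu_{\alpha_i,\beta}\frac{1}{\beta!}\partial_\xi^\beta$; (3) $0=\operatorname{ord}(\Lambda_0)\le\cdots\le\operatorname{ord}(\Lambda_{\delta-1})$ and, for every $0\le t\le$ (the maximal order of elements of $\mathscr{D}$), $\mathscr{D}_t=\operatorname{span}\{\Lambda_j:\operatorname{ord}(\Lambda_j)\le t\}$. *)

theory Defs
  imports
    "Jordan_Normal_Form.Matrix"
    "HOL-Library.Poly_Mapping"
    "HOL-Analysis.Function_Topology"
    "HOL-Analysis.Isolated"
    "HOL-Algebra.Ideal_Product"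
    "HOL-Algebra.Subrings"
begin

unbundle no vec_syntax

section \<open>Multivariate polynomials\<close>

type_synonym 'v expo = "'v \<Rightarrow>\<^sub>0 nat"
type_synonym 'v mpoly = "'v expo \<Rightarrow>\<^sub>0 complex"

text \<open>The variables \<open>x\<^sub>1, \<dots>, x\<^sub>n\<close> are indexed by a type \<open>'n :: {finite, linorder}\<close>, so \<open>n\<close> is
  \<open>CARD('n)\<close> and \<open>\<complex>[x]\<close> is the whole type \<open>'n mpoly\<close>. The linear order is only used for the order
  of the factors in a product of multiplication matrices.\<close>

definition unit_expo :: "'v \<Rightarrow> 'v expo" where
  "unit_expo j = Poly_Mapping.single j 1"

definition expo_deg :: "'n::finite expo \<Rightarrow> nat" where
  "expo_deg a = (\<Sum>j\<in>UNIV. Poly_Mapping.lookup a j)"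

definition expo_fact :: "'n::finite expo \<Rightarrow> complex" where
  "expo_fact a = (\<Prod>j\<in>UNIV. fact (Poly_Mapping.lookup a j))"

definition Const :: "complex \<Rightarrow> 'v mpoly" where
  "Const c = Poly_Mapping.single 0 c"

definition Var :: "'v \<Rightarrow> 'v mpoly" where
  "Var v = Poly_Mapping.single (unit_expo v) 1"

definition mpoly_subst :: "(complex \<Rightarrow> 'r) \<Rightarrow> ('v \<Rightarrow> 'r) \<Rightarrow> 'v mpoly \<Rightarrow> 'r::comm_ring_1" where
  "mpoly_subst \<phi> z p =
     (\<Sum>m\<in>Poly_Mapping.keys p. \<phi> (Poly_Mapping.lookup p m) *
        (\<Prod>v\<in>Poly_Mapping.keys m. z v ^ Poly_Mapping.lookup m v))"

definition mpoly_eval :: "('v \<Rightarrow> complex) \<Rightarrow> 'v mpoly \<Rightarrow> complex" where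
  "mpoly_eval = mpoly_subst (\<lambda>c. c)"

definition pderiv_var :: "'v \<Rightarrow> 'v mpoly \<Rightarrow> 'v mpoly" where
  "pderiv_var v p =
     (\<Sum>m\<in>Poly_Mapping.keys p. Poly_Mapping.single (m - unit_expo v)
        (of_nat (Poly_Mapping.lookup m v) * Poly_Mapping.lookup p m))"

definition pderiv_expo :: "'n::{finite,linorder} expo \<Rightarrow> 'n mpoly \<Rightarrow> 'n mpoly" where
  "pderiv_expo g = foldr (\<lambda>v. pderiv_var v ^^ Poly_Mapping.lookup g v) (sorted_list_of_set UNIV)"

definition complex_ring :: "complex ring" where
  "complex_ring = \<lparr>carrier = UNIV, mult = (*), one = 1, zero = 0, add = (+)\<rparr>"

definition mpoly_ring :: "complex set \<Rightarrow> 'v set \<Rightarrow> 'v mpoly ring" where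
  "mpoly_ring K V =
     \<lparr>carrier = {p. range (Poly_Mapping.lookup p) \<subseteq> K \<and>
                    (\<forall>m\<in>Poly_Mapping.keys p. Poly_Mapping.keys m \<subseteq> V)},
      mult = (*), one = 1, zero = 0, add = (+)\<rparr>"

abbreviation Cx :: "'v mpoly ring" where
  "Cx \<equiv> mpoly_ring UNIV UNIV"


section \<open>Primary decomposition\<close>

definition primary_ideal :: "'a set \<Rightarrow> ('a, 'b) ring_scheme \<Rightarrow> bool" where
  "primary_ideal q R \<longleftrightarrow> ideal q R \<and> q \<noteq> carrier R \<and>
     (\<forall>a\<in>carrier R. \<forall>b\<in>carrier R. a \<otimes>\<^bsub>R\<^esub> b \<in> q \<longrightarrow> a \<in> q \<or> (\<exists>k::nat. b [^]\<^bsub>R\<^esub> k \<in> q))"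

definition ideal_radical :: "('a, 'b) ring_scheme \<Rightarrow> 'a set \<Rightarrow> 'a set" where
  "ideal_radical R J = {a \<in> carrier R. \<exists>k::nat. a [^]\<^bsub>R\<^esub> k \<in> J}"

definition minimal_primary_decomposition ::
  "('a, 'b) ring_scheme \<Rightarrow> 'a set \<Rightarrow> 'a set set \<Rightarrow> bool" where
  "minimal_primary_decomposition R J P \<longleftrightarrow>
     finite P \<and> (\<forall>q\<in>P. primary_ideal q R) \<and> J = carrier R \<inter> \<Inter>P \<and>
     inj_on (ideal_radical R) P \<and> (\<forall>q\<in>P. J \<noteq> carrier R \<inter> \<Inter>(P - {q}))"

definition max_ideal :: "('v \<Rightarrow> complex) \<Rightarrow> 'v mpoly set" where
  "max_ideal \<xi> = {p. mpoly_eval \<xi> p = 0}"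

text \<open>With \<open>P\<close> the set of primary components of \<open>I\<close>, this is \<open>I\<^sub>\<xi>\<close>. The components contained in
  \<open>\<mm>\<^sub>\<xi>\<close> may be embedded; their intersection does not depend on the choice of \<open>P\<close>. It is \<open>\<complex>[x]\<close> if
  there are none.\<close>

definition component_at :: "('v \<Rightarrow> complex) \<Rightarrow> 'v mpoly set set \<Rightarrow> 'v mpoly set" where
  "component_at \<xi> P = \<Inter>{q \<in> P. q \<subseteq> max_ideal \<xi>}"


section \<open>The deflated ideal\<close>

text \<open>The exponent set \<open>E\<close> is enumerated by \<open>\<alpha> 0, \<dots>, \<alpha> (\<delta> - 1)\<close>. The order \<open>\<le>\<close> of the library on
  \<open>'n expo\<close> is lexicographic, hence the componentwise comparison is written out.\<close>

definition stable_under_subtraction :: "'v expo set \<Rightarrow> bool" where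
  "stable_under_subtraction E \<longleftrightarrow>
     (\<forall>a\<in>E. \<forall>b. (\<forall>j. Poly_Mapping.lookup b j \<le> Poly_Mapping.lookup a j) \<longrightarrow> b \<in> E)"

abbreviation exponents :: "(nat \<Rightarrow> 'n expo) \<Rightarrow> nat \<Rightarrow> 'n expo set" where
  "exponents \<alpha> \<delta> \<equiv> \<alpha> ` {..<\<delta>}"

datatype 'n dvar = X 'n | Mu "'n expo \<times> 'n expo"

definition mu_index :: "(nat \<Rightarrow> 'n::finite expo) \<Rightarrow> nat \<Rightarrow> ('n expo \<times> 'n expo) set" where
  "mu_index \<alpha> \<delta> =
     {(\<alpha> i, \<alpha> k + unit_expo j) | i k j. i < \<delta> \<and> k < \<delta> \<and> expo_deg (\<alpha> i) \<ge> expo_deg (\<alpha> k) + 1 \<and>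
        \<alpha> k + unit_expo j \<notin> exponents \<alpha> \<delta>}"

definition deflated_ring ::
  "complex set \<Rightarrow> (nat \<Rightarrow> 'n::finite expo) \<Rightarrow> nat \<Rightarrow> 'n dvar mpoly ring" where
  "deflated_ring K \<alpha> \<delta> = mpoly_ring K (range X \<union> Mu ` mu_index \<alpha> \<delta>)"

definition mult_mat :: "(nat \<Rightarrow> 'n::finite expo) \<Rightarrow> nat \<Rightarrow> 'n \<Rightarrow> 'n dvar mpoly mat" where
  "mult_mat \<alpha> \<delta> i = transpose_mat (Matrix.mat \<delta> \<delta> (\<lambda>(k, l).
     if \<alpha> l = \<alpha> k + unit_expo i then 1
     else if \<alpha> k + unit_expo i \<notin> exponents \<alpha> \<delta> \<and> expo_deg (\<alpha> l) \<ge> expo_deg (\<alpha> k) + 1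
       then Var (Mu (\<alpha> l, \<alpha> k + unit_expo i))
     else 0))"

definition mult_mat_expo ::
  "(nat \<Rightarrow> 'n::{finite,linorder} expo) \<Rightarrow> nat \<Rightarrow> 'n expo \<Rightarrow> 'n dvar mpoly mat" where
  "mult_mat_expo \<alpha> \<delta> g =
     foldr (\<lambda>i A. (mult_mat \<alpha> \<delta> i ^\<^sub>m Poly_Mapping.lookup g i) * A) (sorted_list_of_set UNIV) (1\<^sub>m \<delta>)"

text \<open>\<open>Sum_any\<close> is the sum over all exponents of a finitely supported family: only finitely many
  derivatives of \<open>p\<close> are non-zero.\<close>

definition param_normal_form ::
  "(nat \<Rightarrow> 'n::{finite,linorder} expo) \<Rightarrow> nat \<Rightarrow> 'n mpoly \<Rightarrow> 'n dvar mpoly Matrix.vec" where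
  "param_normal_form \<alpha> \<delta> p = Matrix.vec \<delta> (\<lambda>i. Sum_any (\<lambda>g.
     Const (1 / expo_fact g) * mpoly_subst Const (\<lambda>j. Var (X j)) (pderiv_expo g p) *
       (mult_mat_expo \<alpha> \<delta> g *\<^sub>v unit_vec \<delta> 0) $ i))"

definition deflated_ideal ::
  "complex set \<Rightarrow> (nat \<Rightarrow> 'n::{finite,linorder} mpoly) \<Rightarrow> nat \<Rightarrow> (nat \<Rightarrow> 'n expo) \<Rightarrow> nat \<Rightarrow>
    'n dvar mpoly set" where
  "deflated_ideal K f N \<alpha> \<delta> = genideal (deflated_ring K \<alpha> \<delta>)
     ({param_normal_form \<alpha> \<delta> (f k) $ i | k i. k < N \<and> i < \<delta>} \<union>
      {(mult_mat \<alpha> \<delta> i * mult_mat \<alpha> \<delta> j - mult_mat \<alpha> \<delta> j * mult_mat \<alpha> \<delta> i) $$ (k, l) | i j k l.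
         k < \<delta> \<and> l < \<delta>})"

text \<open>\<open>\<complex>\<^sup>D\<close> is represented by the functions that are \<open>undefined\<close> outside the finite set
  \<open>mu_index \<alpha> \<delta>\<close>; on these the product topology is the usual one.\<close>

definition deflated_solutions ::
  "complex set \<Rightarrow> (nat \<Rightarrow> 'n::{finite,linorder} mpoly) \<Rightarrow> nat \<Rightarrow> (nat \<Rightarrow> 'n expo) \<Rightarrow> nat \<Rightarrow>
    (('n \<Rightarrow> complex) \<times> ('n expo \<times> 'n expo \<Rightarrow> complex)) set" where
  "deflated_solutions K f N \<alpha> \<delta> =
     {(\<xi>, \<nu>). \<nu> \<in> extensional (mu_index \<alpha> \<delta>) \<and>
        (\<forall>p\<in>deflated_ideal K f N \<alpha> \<delta>. mpoly_eval (case_dvar \<xi> \<nu>) p = 0)}"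


section \<open>Orthogonal primal-dual basis pairs\<close>

text \<open>An element of \<open>\<complex>[\<partial>\<^sub>\<xi>]\<close> is given by its coefficients with respect to the \<open>\<partial>\<^sub>\<xi>\<^sup>\<beta>\<close>, which are linearly
  independent functionals.\<close>

type_synonym 'n dfun = "'n expo \<Rightarrow>\<^sub>0 complex"

definition dfun_apply :: "('n \<Rightarrow> complex) \<Rightarrow> 'n::{finite,linorder} dfun \<Rightarrow> 'n mpoly \<Rightarrow> complex" where
  "dfun_apply \<xi> L p =
     (\<Sum>b\<in>Poly_Mapping.keys L. Poly_Mapping.lookup L b * mpoly_eval \<xi> (pderiv_expo b p))"

definition dfun_scale :: "complex \<Rightarrow> 'n dfun \<Rightarrow> 'n dfun" where
  "dfun_scale c = Poly_Mapping.map ((*) c)"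

text \<open>The zero functional gets order 0, so that it belongs to every \<open>\<D>\<^sub>t\<close>.\<close>

definition dfun_ord :: "'n::finite dfun \<Rightarrow> nat" where
  "dfun_ord L = Max (insert 0 (expo_deg ` Poly_Mapping.keys L))"

definition dual_space :: "('n \<Rightarrow> complex) \<Rightarrow> 'n::{finite,linorder} mpoly set \<Rightarrow> 'n dfun set" where
  "dual_space \<xi> Q = {L. \<forall>p\<in>Q. dfun_apply \<xi> L p = 0}"

text \<open>The coefficient of \<open>1/\<beta>! \<partial>\<^sub>\<xi>\<^sup>\<beta>\<close>.\<close>

definition nu_coeff :: "'n::finite dfun \<Rightarrow> 'n expo \<Rightarrow> complex" where
  "nu_coeff L b = expo_fact b * Poly_Mapping.lookup L b"

definition shifted_monomial :: "('n \<Rightarrow> complex) \<Rightarrow> 'n::finite expo \<Rightarrow> 'n mpoly" where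
  "shifted_monomial \<xi> a = (\<Prod>j\<in>UNIV. (Var j - Const (\<xi> j)) ^ Poly_Mapping.lookup a j)"

text \<open>The residue classes of \<open>b 0, \<dots>, b (\<delta> - 1)\<close> form a basis of the quotient by \<open>Q\<close>.\<close>

definition basis_of_quotient :: "'v mpoly set \<Rightarrow> (nat \<Rightarrow> 'v mpoly) \<Rightarrow> nat \<Rightarrow> bool" where
  "basis_of_quotient Q b \<delta> \<longleftrightarrow>
     (\<forall>c. (\<Sum>i<\<delta>. Const (c i) * b i) \<in> Q \<longrightarrow> (\<forall>i<\<delta>. c i = 0)) \<and>
     (\<forall>p. \<exists>c. p - (\<Sum>i<\<delta>. Const (c i) * b i) \<in> Q)"

definition basis_of_dual :: "'n dfun set \<Rightarrow> (nat \<Rightarrow> 'n dfun) \<Rightarrow> nat \<Rightarrow> bool" where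
  "basis_of_dual D L \<delta> \<longleftrightarrow>
     inj_on L {..<\<delta>} \<and> \<not> module.dependent dfun_scale (L ` {..<\<delta>}) \<and>
     module.span dfun_scale (L ` {..<\<delta>}) = D"

definition connected_to_one :: "(nat \<Rightarrow> 'n expo) \<Rightarrow> nat \<Rightarrow> bool" where
  "connected_to_one \<alpha> \<delta> \<longleftrightarrow>
     (\<forall>k<\<delta>. \<alpha> k \<noteq> 0 \<longrightarrow> (\<exists>j<\<delta>. \<exists>i. \<alpha> k = \<alpha> j + unit_expo i))"

text \<open>The primal basis consists of the shifted monomials with exponents \<open>\<alpha> 0, \<dots>, \<alpha> (\<delta> - 1)\<close>, so it is
  given by \<open>\<xi>\<close> and \<open>\<alpha>\<close>. Bounding \<open>t\<close> by the order of some element of \<open>\<D>\<close> is the same as bounding it by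
  the maximal order, since \<open>\<D>\<close> is finite-dimensional.\<close>

definition primal_dual_basis_pair ::
  "('n \<Rightarrow> complex) \<Rightarrow> (nat \<Rightarrow> 'n::{finite,linorder} expo) \<Rightarrow> nat \<Rightarrow> 'n mpoly set \<Rightarrow>
    (nat \<Rightarrow> 'n dfun) \<Rightarrow> bool" where
  "primal_dual_basis_pair \<xi> \<alpha> \<delta> Q L \<longleftrightarrow>
     basis_of_quotient Q (\<lambda>i. shifted_monomial \<xi> (\<alpha> i)) \<delta> \<and> \<alpha> 0 = 0 \<and> connected_to_one \<alpha> \<delta> \<and>
     basis_of_dual (dual_space \<xi> Q) L \<delta> \<and>
     (\<forall>i<\<delta>. \<forall>j<\<delta>. dfun_apply \<xi> (L i) (shifted_monomial \<xi> (\<alpha> j)) = (if i = j then 1 else 0)) \<and>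
     L 0 = Poly_Mapping.single 0 1 \<and>
     (\<forall>i<\<delta>. \<exists>c. L i = Poly_Mapping.single (\<alpha> i) (1 / expo_fact (\<alpha> i)) +
        (\<Sum>b | expo_deg b \<le> expo_deg (\<alpha> i) \<and> b \<notin> exponents \<alpha> \<delta>.
           Poly_Mapping.single b (c b / expo_fact b))) \<and>
     dfun_ord (L 0) = 0 \<and> (\<forall>i j. i \<le> j \<and> j < \<delta> \<longrightarrow> dfun_ord (L i) \<le> dfun_ord (L j)) \<and>
     (\<forall>t. (\<exists>M\<in>dual_space \<xi> Q. t \<le> dfun_ord M) \<longrightarrow>
        {M \<in> dual_space \<xi> Q. dfun_ord M \<le> t} =
        module.span dfun_scale {L j | j. j < \<delta> \<and> dfun_ord (L j) \<le> t})"

end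

theory Submission
  imports Defs
begin

text \<open>
  At a point \<open>(\<xi>, \<nu>)\<close> where the matrices \<open>M\<^sub>i = M\<^sub>i(\<nu>)\<close> commute, \<open>\<complex>\<^sup>\<delta>\<close> is a \<open>\<complex>[x]\<close>-module on which
  \<open>x\<^sub>i - \<xi>\<^sub>i\<close> acts as \<open>M\<^sub>i\<close>. Put \<open>b\<^sub>\<gamma> = M\<^sup>\<gamma>[1]\<close>. Since \<open>E\<close> is stable under subtraction, \<open>b\<close> takes the
  value \<open>e\<^sub>k\<close> at \<open>\<alpha>\<^sub>k\<close>, so \<open>[1]\<close> generates the module. By Taylor's formula the normal form of \<open>p\<close> is
  \<open>p\<close> acting on \<open>[1]\<close>; hence its kernel is an ideal of codimension \<open>\<delta>\<close> with basis \<open>B\<close> of the quotient,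
  and the coordinates of the normal form are the functionals \<open>\<Lambda>\<^sub>l\<close> with
  \<open>\<Lambda>\<^sub>l((x - \<xi>)\<^sup>\<gamma>) = (b\<^sub>\<gamma>)\<^sub>l\<close>. Every \<open>M\<^sub>i\<close> raises degrees, which gives the shape and the orders of the
  \<open>\<Lambda>\<^sub>l\<close> (\<open>primal_dual_basis_pair_kernel\<close>).

  The proof works with the family \<open>b\<close> instead of the matrices. It is the solution of the
  recursion \<open>b\<^sub>0 = e\<^sub>0\<close>, \<open>b\<close> at \<open>\<gamma> + e\<^sub>i\<close> equal to \<open>M\<^sub>i b\<^sub>\<gamma>\<close> (predicate \<open>moments\<close>). A solution is unique, and it
  exists exactly if the matrices commute. So the solutions of the deflated ideal are the \<open>(\<xi>, \<nu>)\<close>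
  with a family of moments whose normal form kills every \<open>f\<^sub>k\<close> (\<open>deflated_solutions_iff\<close>). The
  values \<open>\<Lambda>'\<^sub>l((x - \<xi>)\<^sup>\<gamma>)\<close> of an arbitrary basis pair with the coefficients \<open>\<nu>\<close> are moments for \<open>\<nu>\<close> as well
  (\<open>primal_dual_basis_pair_moments\<close>), and this is why \<open>(\<xi>, \<nu>)\<close> determines the pair.

  It remains to see that the kernel is \<open>Q = I\<^sub>\<xi> + \<mm>\<^sub>\<xi>\<^sup>d\<^sup>+\<^sup>1\<close> (\<open>kernel_eq_local_component\<close>). The kernel contains \<open>Q\<close>
  because a polynomial that vanishes at \<open>\<xi>\<close> raises degrees and one that does not vanish at \<open>\<xi>\<close> acts
  injectively. The other inclusion is where isolatedness enters (\<open>isolated_imp_kernel_subset\<close>). If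
  \<open>Q\<close> were strictly smaller than the kernel, there would be a functional \<open>\<Lambda> \<noteq> 0\<close> that vanishes on
  \<open>Q\<close>, on \<open>B\<close> and on \<open>\<mm>\<^sub>\<xi>\<close> times the kernel. Replacing \<open>\<Lambda>\<close> with index \<open>\<delta> - 1\<close> by itself plus \<open>t \<Lambda>\<close>
  changes only \<open>\<nu>\<close>, linearly in \<open>t\<close>, and gives a solution for every \<open>t\<close>: a line through \<open>(\<xi>, \<nu>)\<close>
  that consists of solutions. As \<open>(\<xi>, \<nu>)\<close> is isolated, \<open>\<nu>\<close> does not change for some \<open>t \<noteq> 0\<close>; but
  then the moments do not change either, and \<open>\<Lambda> = 0\<close>.
\<close>

abbreviation lookup :: "('a \<Rightarrow>\<^sub>0 'b::zero) \<Rightarrow> 'a \<Rightarrow> 'b" where "lookup \<equiv> Poly_Mapping.lookup"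
abbreviation keys :: "('a \<Rightarrow>\<^sub>0 'b::zero) \<Rightarrow> 'a set" where "keys \<equiv> Poly_Mapping.keys"

section \<open>Polynomials as linear combinations of monomials\<close>

text \<open>Linear statements need only be checked on monomials; the zero polynomial is the monomial
  with coefficient 0.\<close>

lemma mpoly_induct_add [case_names single add]:
  fixes p :: "'a \<Rightarrow>\<^sub>0 'b::comm_monoid_add"
  assumes "\<And>m c. P (Poly_Mapping.single m c)" and "\<And>p q. P p \<Longrightarrow> P q \<Longrightarrow> P (p + q)"
  shows "P p"
proof -
  have z: "P 0" using assms(1)[of undefined 0] by simp
  have "P (\<Sum>m\<in>A. Poly_Mapping.single m (lookup p m))" if "finite A" for A
    using that by induction (simp_all add: z assms)
  moreover have "p = (\<Sum>m\<in>keys p. Poly_Mapping.single m (lookup p m))"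
    by (rule poly_mapping_eqI) (auto simp: lookup_sum lookup_single when_def in_keys_iff)
  ultimately show ?thesis by (metis finite_keys)
qed

text \<open>The linear extension of a map \<open>c\<close> defined on monomials, semilinear along \<open>\<phi>\<close>. Substitutions,
  differential functionals and normal forms are all of this kind.\<close>

definition lincomb :: "('b::zero \<Rightarrow> 'r::comm_ring_1) \<Rightarrow> ('a \<Rightarrow> 'r) \<Rightarrow> ('a \<Rightarrow>\<^sub>0 'b) \<Rightarrow> 'r" where
  "lincomb \<phi> c p = (\<Sum>m\<in>keys p. \<phi> (lookup p m) * c m)"

lemma lincomb_superset:
  assumes "\<phi> 0 = 0" "finite A" "\<And>m. m \<in> keys p \<Longrightarrow> m \<notin> A \<Longrightarrow> c m = 0"
  shows "lincomb \<phi> c p = (\<Sum>m\<in>A. \<phi> (lookup p m) * c m)"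
proof -
  have "lincomb \<phi> c p = (\<Sum>m\<in>keys p \<union> A. \<phi> (lookup p m) * c m)"
    unfolding lincomb_def by (rule sum.mono_neutral_left) (use assms in \<open>auto simp: in_keys_iff\<close>)
  also have "\<dots> = (\<Sum>m\<in>A. \<phi> (lookup p m) * c m)"
    by (rule sum.mono_neutral_right) (use assms in \<open>auto simp: in_keys_iff\<close>)
  finally show ?thesis .
qed

lemma lincomb_single [simp]: "\<phi> 0 = 0 \<Longrightarrow> lincomb \<phi> c (Poly_Mapping.single m a) = \<phi> a * c m"
  by (cases "a = 0") (simp_all add: lincomb_def)

lemma lincomb_zero [simp]: "lincomb \<phi> c 0 = 0"
  by (simp add: lincomb_def)

lemma lincomb_add:
  fixes p q :: "'a \<Rightarrow>\<^sub>0 'b::comm_monoid_add"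
  assumes "\<phi> 0 = 0" "\<And>a b. \<phi> (a + b) = \<phi> a + \<phi> b"
  shows "lincomb \<phi> c (p + q) = lincomb \<phi> c p + lincomb \<phi> c q"
proof -
  let ?A = "keys p \<union> keys q"
  have "lincomb \<phi> c r = (\<Sum>m\<in>?A. \<phi> (lookup r m) * c m)" if "keys r \<subseteq> ?A" for r
    using that assms(1) by (intro lincomb_superset) auto
  then show ?thesis
    using keys_add[of p q] by (simp add: lookup_add assms(2) algebra_simps sum.distrib)
qed

lemma lincomb_coeff_add: "lincomb \<phi> (\<lambda>m. c m + c' m) p = lincomb \<phi> c p + lincomb \<phi> c' p"
  by (simp add: lincomb_def algebra_simps sum.distrib)

lemma lincomb_coeff_scale: "lincomb \<phi> (\<lambda>m. a * c m) p = a * lincomb \<phi> c p"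
  by (simp add: lincomb_def sum_distrib_left mult.left_commute)

lemma lincomb_coeff_scale_right: "lincomb \<phi> (\<lambda>m. c m * a) p = lincomb \<phi> c p * a"
  using lincomb_coeff_scale[of \<phi> a c p] by (simp only: mult.commute[of _ a])

lemma lincomb_coeff_sum: "lincomb \<phi> (\<lambda>m. \<Sum>k\<in>A. c k m) p = (\<Sum>k\<in>A. lincomb \<phi> (c k) p)"
  unfolding lincomb_def sum_distrib_left by (rule sum.swap)

text \<open>Only the coefficient maps \<open>id\<close> and \<open>Const\<close> occur.\<close>

abbreviation coeff_hom :: "(complex \<Rightarrow> 'r::comm_ring_1) \<Rightarrow> bool" where
  "coeff_hom \<phi> \<equiv> \<phi> 0 = 0 \<and> \<phi> 1 = 1 \<and> (\<forall>a b. \<phi> (a + b) = \<phi> a + \<phi> b) \<and> (\<forall>a b. \<phi> (a * b) = \<phi> a * \<phi> b)"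

lemma lincomb_mult:
  fixes p q :: "'v mpoly"
  assumes "coeff_hom \<phi>"
  shows "lincomb \<phi> c (p * q) = lincomb \<phi> (\<lambda>m. lincomb \<phi> (\<lambda>n. c (m + n)) q) p"
proof (induction p rule: mpoly_induct_add)
  case (single m a)
  show ?case
  proof (induction q rule: mpoly_induct_add)
    case (single n b)
    show ?case using assms by (simp add: mult_single mult.assoc)
  next
    case (add p q)
    then show ?case using assms by (simp add: algebra_simps lincomb_add)
  qed
next
  case (add p q)
  then show ?case using assms by (simp add: distrib_right lincomb_add)
qed

lemma lincomb_Const_mult: "coeff_hom \<phi> \<Longrightarrow> lincomb \<phi> c (Const a * p) = \<phi> a * lincomb \<phi> c p"
  by (simp add: lincomb_mult) (simp add: Const_def)

definition monomial_value :: "('v \<Rightarrow> 'r::comm_ring_1) \<Rightarrow> 'v expo \<Rightarrow> 'r" where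
  "monomial_value z m = (\<Prod>v\<in>keys m. z v ^ lookup m v)"

lemma mpoly_subst_lincomb: "mpoly_subst \<phi> z = lincomb \<phi> (monomial_value z)"
  by (rule ext) (simp add: mpoly_subst_def lincomb_def monomial_value_def)

lemma monomial_value_superset:
  assumes "finite A" "keys m \<subseteq> A"
  shows "monomial_value z m = (\<Prod>v\<in>A. z v ^ lookup m v)"
  unfolding monomial_value_def
  by (rule prod.mono_neutral_left) (use assms in \<open>auto simp: in_keys_iff\<close>)

lemma monomial_value_add: "monomial_value z (m + n) = monomial_value z m * monomial_value z n"
proof -
  let ?A = "keys m \<union> keys n"
  have "monomial_value z r = (\<Prod>v\<in>?A. z v ^ lookup r v)" if "keys r \<subseteq> ?A" for r
    using that by (intro monomial_value_superset) auto
  then show ?thesis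
    using keys_add[of m n] by (simp add: lookup_add power_add prod.distrib)
qed

lemma monomial_value_zero [simp]: "monomial_value z 0 = 1"
  by (simp add: monomial_value_def)

lemma monomial_value_unit [simp]: "monomial_value z (unit_expo v) = z v"
  by (simp add: monomial_value_def unit_expo_def)

lemma monomial_value_UNIV: "monomial_value z (m :: 'n::finite expo) = (\<Prod>v\<in>UNIV. z v ^ lookup m v)"
  by (rule monomial_value_superset) auto

text \<open>Induction along the steps \<open>g \<mapsto> g + e\<^sub>i\<close>, which is how families of moments are defined.\<close>

lemma expo_induct [case_names zero unit]:
  fixes g :: "'v expo"
  assumes "P 0" and "\<And>g i. P g \<Longrightarrow> P (g + unit_expo i)"
  shows "P g"
proof -
  have single: "P (g + Poly_Mapping.single i k)" if "P g" for g i k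
  proof (induction k)
    case (Suc k)
    have "g + Poly_Mapping.single i (Suc k) = (g + Poly_Mapping.single i k) + unit_expo i"
      by (simp add: unit_expo_def add.assoc flip: single_add)
    then show ?case using assms(2)[OF Suc] by simp
  qed (simp add: that)
  have "P (h + g)" if "P h" for h
    using that by (induction g arbitrary: h rule: mpoly_induct_add)
      (simp_all add: single flip: add.assoc)
  then show ?thesis using assms(1) by (metis add_0)
qed

section \<open>Substitution is a ring homomorphism\<close>

lemma mpoly_subst_zero [simp]: "mpoly_subst \<phi> z 0 = 0"
  by (simp add: mpoly_subst_lincomb)

lemma mpoly_subst_add:
  "coeff_hom \<phi> \<Longrightarrow> mpoly_subst \<phi> z (p + q) = mpoly_subst \<phi> z p + mpoly_subst \<phi> z q"
  by (simp add: mpoly_subst_lincomb lincomb_add)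

lemma mpoly_subst_mult:
  assumes "coeff_hom \<phi>"
  shows "mpoly_subst \<phi> z (p * q) = mpoly_subst \<phi> z p * mpoly_subst \<phi> z q"
  unfolding mpoly_subst_lincomb lincomb_mult[OF assms] monomial_value_add
  by (simp only: lincomb_coeff_scale[of \<phi> "monomial_value z _"] lincomb_coeff_scale_right)

lemma mpoly_subst_Const [simp]: "\<phi> 0 = 0 \<Longrightarrow> mpoly_subst \<phi> z (Const a) = \<phi> a"
  by (simp add: mpoly_subst_lincomb Const_def)

lemma mpoly_subst_Var [simp]: "coeff_hom \<phi> \<Longrightarrow> mpoly_subst \<phi> z (Var v) = z v"
  by (simp add: mpoly_subst_lincomb Var_def)

lemma Const_simps [simp]:
  "Const 0 = 0" "Const 1 = 1"
  by (simp_all add: Const_def)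

lemma Const_add: "Const (a + b) = Const a + Const b"
  by (simp add: Const_def single_add)

lemma Const_mult: "Const (a * b) = Const a * Const b"
  by (simp add: Const_def mult_single)

lemma mpoly_induct [case_names Const Var add mult]:
  fixes p :: "'v mpoly"
  assumes "\<And>c. P (Const c)" "\<And>v. P (Var v)"
    and "\<And>p q. P p \<Longrightarrow> P q \<Longrightarrow> P (p + q)" "\<And>p q. P p \<Longrightarrow> P q \<Longrightarrow> P (p * q)"
  shows "P p"
proof (induction p rule: mpoly_induct_add)
  case (single m c)
  have "P (Poly_Mapping.single m 1)"
  proof (induction m rule: expo_induct)
    case zero
    show ?case using assms(1)[of 1] by (simp add: Const_def)
  next
    case (unit g i)
    have "Poly_Mapping.single (g + unit_expo i) 1 = Poly_Mapping.single g 1 * Var i"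
      by (simp add: Var_def mult_single)
    then show ?case using assms(2,4) unit by metis
  qed
  moreover have "Poly_Mapping.single m c = Const c * Poly_Mapping.single m 1"
    by (simp add: Const_def mult_single)
  ultimately show ?case using assms(1,4) by metis
qed (rule assms(3))

lemma mpoly_eval_simps [simp]:
  "mpoly_eval z 0 = 0" "mpoly_eval z (Const a) = a" "mpoly_eval z (Var v) = z v"
  "mpoly_eval z (p + q) = mpoly_eval z p + mpoly_eval z q"
  "mpoly_eval z (p * q) = mpoly_eval z p * mpoly_eval z q"
  by (simp_all add: mpoly_eval_def mpoly_subst_add mpoly_subst_mult)

lemma mpoly_eval_1 [simp]: "mpoly_eval z 1 = 1"
  using mpoly_eval_simps(2)[of z 1] by simp

lemma mpoly_eval_uminus [simp]: "mpoly_eval z (- p) = - mpoly_eval z p"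
  using mpoly_eval_simps(4)[of z p "- p"] by (simp add: add_eq_0_iff)

lemma mpoly_eval_diff [simp]: "mpoly_eval z (p - q) = mpoly_eval z p - mpoly_eval z q"
  using mpoly_eval_simps(4)[of z p "- q"] by simp

lemma mpoly_eval_sum [simp]: "mpoly_eval z (sum f A) = (\<Sum>a\<in>A. mpoly_eval z (f a))"
  by (induction A rule: infinite_finite_induct) simp_all

lemma mpoly_eval_rename [simp]:
  "mpoly_eval z (mpoly_subst Const (\<lambda>j. Var (h j)) p) = mpoly_eval (\<lambda>j. z (h j)) p"
proof (induction p rule: mpoly_induct)
qed (simp_all add: mpoly_subst_add mpoly_subst_mult Const_add Const_mult)

section \<open>Taylor expansion\<close>

text \<open>The substitution of \<open>x + \<xi>\<close> for \<open>x\<close>. The coefficients of the result are the Taylor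
  coefficients at \<open>\<xi>\<close>.\<close>

definition taylor :: "('v \<Rightarrow> complex) \<Rightarrow> 'v mpoly \<Rightarrow> 'v mpoly" where
  "taylor \<xi> = mpoly_subst Const (\<lambda>v. Var v + Const (\<xi> v))"

lemma taylor_simps [simp]:
  "taylor \<xi> 0 = 0" "taylor \<xi> (Const c) = Const c" "taylor \<xi> (Var v) = Var v + Const (\<xi> v)"
  "taylor \<xi> (p + q) = taylor \<xi> p + taylor \<xi> q" "taylor \<xi> (p * q) = taylor \<xi> p * taylor \<xi> q"
  by (simp_all add: taylor_def mpoly_subst_add mpoly_subst_mult Const_add Const_mult)

lemma taylor_1 [simp]: "taylor \<xi> 1 = 1"
  using taylor_simps(2)[of \<xi> 1] by simp

lemma taylor_uminus [simp]: "taylor \<xi> (- p) = - taylor \<xi> p"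
  using taylor_simps(4)[of \<xi> p "- p"] by (simp add: add_eq_0_iff)

lemma taylor_diff [simp]: "taylor \<xi> (p - q) = taylor \<xi> p - taylor \<xi> q"
  using taylor_simps(4)[of \<xi> p "- q"] by simp

lemma taylor_sum [simp]: "taylor \<xi> (sum f A) = (\<Sum>a\<in>A. taylor \<xi> (f a))"
  by (induction A rule: infinite_finite_induct) simp_all

lemma taylor_inverse: "taylor (\<lambda>v. - \<xi> v) (taylor \<xi> p) = p"
proof (induction p rule: mpoly_induct)
  case (Var v)
  have "Const (- \<xi> v) + Const (\<xi> v) = (0 :: 'a mpoly)" by (simp flip: Const_add)
  then show ?case by (simp add: add.assoc)
qed simp_all

lemma inj_taylor: "taylor \<xi> p = taylor \<xi> q \<Longrightarrow> p = q"
  by (metis taylor_inverse)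

lemma lookup_mult_0: "lookup (p * q) 0 = lookup p 0 * lookup (q :: 'n::finite mpoly) 0"
proof -
  have z: "m + n = 0 \<longleftrightarrow> m = 0 \<and> n = (0 :: 'n expo)" for m n
    by (auto simp: poly_mapping_eq_iff fun_eq_iff lookup_add)
  have *: "lookup r 0 = lincomb (\<lambda>c. c) (\<lambda>m. if m = 0 then 1 else 0) r" for r :: "'n mpoly"
    by (subst lincomb_superset[where A = "{0}"]) auto
  have "lookup (p * q) 0 = lincomb (\<lambda>c. c) (\<lambda>m. if m = 0 then lookup q 0 else 0) p"
    unfolding * by (subst lincomb_mult) (auto simp: z lincomb_def intro!: sum.cong)
  also have "\<dots> = lookup p 0 * lookup q 0"
    by (subst lincomb_superset[where A = "{0}"]) auto
  finally show ?thesis .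
qed

lemma lookup_Const: "lookup (Const c) m = (if m = 0 then c else 0)"
  by (auto simp: Const_def lookup_single when_def)

lemma unit_expo_neq_0 [simp]: "unit_expo v \<noteq> 0"
  by (auto simp: unit_expo_def poly_mapping_eq_iff fun_eq_iff lookup_single when_def)

lemma lookup_Var_0 [simp]: "lookup (Var v) 0 = 0"
  by (simp add: Var_def lookup_single)

lemma lookup_taylor_0: "lookup (taylor \<xi> p) 0 = mpoly_eval \<xi> (p :: 'n::finite mpoly)"
proof (induction p rule: mpoly_induct)
qed (simp_all add: lookup_Const lookup_add lookup_mult_0)

section \<open>Derivatives\<close>

lemma pderiv_var_lincomb:
  "pderiv_var v = lincomb Const (\<lambda>m. Poly_Mapping.single (m - unit_expo v) (of_nat (lookup m v)))"
  by (rule ext) (simp add: pderiv_var_def lincomb_def Const_def mult_single mult.commute)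

lemma pderiv_var_single:
  "pderiv_var v (Poly_Mapping.single m a) = Poly_Mapping.single (m - unit_expo v) (of_nat (lookup m v) * a)"
  by (simp add: pderiv_var_lincomb Const_def mult_single mult.commute)

lemma pderiv_var_add [simp]: "pderiv_var v (p + q) = pderiv_var v p + pderiv_var v q"
  by (simp add: pderiv_var_lincomb lincomb_add Const_add)

lemma minus_unit_expo_add:
  "lookup m v \<noteq> 0 \<Longrightarrow> (m - unit_expo v) + n = (m + n) - unit_expo v"
  by (rule poly_mapping_eqI) (auto simp: lookup_add lookup_minus unit_expo_def lookup_single when_def)

lemma pderiv_var_mult [simp]: "pderiv_var v (p * q) = pderiv_var v p * q + p * pderiv_var v q"
proof (induction p rule: mpoly_induct_add)
  case (single m a)
  show ?case
  proof (induction q rule: mpoly_induct_add)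
    case (single n b)
    have 1: "Poly_Mapping.single (m - unit_expo v + n) (of_nat (lookup m v) * a * b) =
      Poly_Mapping.single (m + n - unit_expo v) (of_nat (lookup m v) * a * b)"
      by (cases "lookup m v = 0") (simp_all add: minus_unit_expo_add)
    have 2: "Poly_Mapping.single (m + (n - unit_expo v)) (a * (of_nat (lookup n v) * b)) =
      Poly_Mapping.single (m + n - unit_expo v) (a * (of_nat (lookup n v) * b))"
      using minus_unit_expo_add[of n v m] by (cases "lookup n v = 0") (simp_all add: add.commute)
    have "of_nat (lookup (m + n) v) * (a * b) = of_nat (lookup m v) * a * b + a * (of_nat (lookup n v) * b)"
      by (simp add: lookup_add algebra_simps)
    then show ?case
      by (simp only: pderiv_var_single mult_single 1 2 single_add)
  qed (simp add: algebra_simps)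
qed (simp add: algebra_simps)

lemma pderiv_var_Const [simp]: "pderiv_var v (Const c) = 0"
  by (simp add: Const_def pderiv_var_single)

lemma pderiv_var_Var: "pderiv_var v (Var w) = Const (if v = w then 1 else 0)"
  by (simp add: Var_def pderiv_var_single unit_expo_def Const_def lookup_single when_def)

lemma taylor_pderiv_var: "taylor \<xi> (pderiv_var v p) = pderiv_var v (taylor \<xi> p)"
proof (induction p rule: mpoly_induct)
qed (simp_all add: pderiv_var_Var)

lemma lookup_pderiv_var:
  "lookup (pderiv_var v p) m = of_nat (lookup m v + 1) * lookup p (m + unit_expo v)"
proof (induction p rule: mpoly_induct_add)
  case (single n a)
  have "n - unit_expo v = m \<longleftrightarrow> n = m + unit_expo v" if "lookup n v \<noteq> 0"
    using that minus_unit_expo_add[of n v "unit_expo v"] by auto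
  moreover have "lookup n v = lookup m v + 1" if "n = m + unit_expo v"
    using that by (simp add: lookup_add unit_expo_def)
  ultimately show ?case
    by (cases "lookup n v = 0") (auto simp: pderiv_var_single lookup_single when_def)
qed (simp add: lookup_add algebra_simps)

text \<open>The factor \<open>fact (lookup m v)\<close> on the left replaces a falling factorial on the right.\<close>

lemma lookup_pderiv_var_iterate:
  "fact (lookup m v) * lookup ((pderiv_var v ^^ k) p) m =
     fact (lookup m v + k) * lookup p (m + Poly_Mapping.single v k)"
proof (induction k arbitrary: m)
  case (Suc k)
  have "fact (lookup m v) * lookup ((pderiv_var v ^^ Suc k) p) m =
      fact (lookup (m + unit_expo v) v) * lookup ((pderiv_var v ^^ k) p) (m + unit_expo v)"
    by (simp add: lookup_pderiv_var lookup_add unit_expo_def algebra_simps)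
  also have "\<dots> = fact (lookup m v + Suc k) * lookup p (m + Poly_Mapping.single v (Suc k))"
    unfolding Suc by (simp add: lookup_add unit_expo_def add.assoc flip: single_add)
  finally show ?case .
qed simp

text \<open>All \<open>g v\<close> derivatives in the variable \<open>v\<close> are taken at an exponent without \<open>v\<close>, so each variable
  contributes exactly the factor \<open>(g v)!\<close>.\<close>

lemma lookup_pderiv_expo_0: "lookup (pderiv_expo g p) 0 = expo_fact g * lookup p g"
proof -
  \<comment> \<open>The outermost derivative is peeled off, which moves its share of \<open>g\<close> into \<open>m\<close>; hence \<open>m\<close> is general.\<close>
  have *: "lookup (foldr (\<lambda>v. pderiv_var v ^^ lookup g v) xs p) m =
      (\<Prod>v\<in>set xs. fact (lookup g v)) *
      lookup p (m + (\<Sum>v\<in>set xs. Poly_Mapping.single v (lookup g v)))"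
    if "distinct xs" "\<And>v. v \<in> set xs \<Longrightarrow> lookup m v = 0" for xs m
    using that
  proof (induction xs arbitrary: m)
    case (Cons v xs)
    let ?k = "lookup g v"
    let ?q = "foldr (\<lambda>v. pderiv_var v ^^ lookup g v) xs p"
    have m: "lookup m v = 0" using Cons.prems by simp
    have "lookup (foldr (\<lambda>v. pderiv_var v ^^ lookup g v) (v # xs) p) m =
        fact ?k * lookup ?q (m + Poly_Mapping.single v ?k)"
      using lookup_pderiv_var_iterate[of m v ?k ?q] m by simp
    also have "lookup ?q (m + Poly_Mapping.single v ?k) =
        (\<Prod>v\<in>set xs. fact (lookup g v)) *
        lookup p (m + Poly_Mapping.single v ?k + (\<Sum>v\<in>set xs. Poly_Mapping.single v (lookup g v)))"
      by (rule Cons.IH) (use Cons.prems in \<open>auto simp: lookup_add lookup_single when_def\<close>)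
    finally show ?case using Cons.prems by (simp add: add.assoc)
  qed simp
  have "(\<Sum>v\<in>UNIV. Poly_Mapping.single v (lookup g v)) = g"
    by (rule poly_mapping_eqI) (simp add: lookup_sum lookup_single when_def)
  then show ?thesis
    using *[of "sorted_list_of_set UNIV" 0] by (simp add: pderiv_expo_def expo_fact_def)
qed

lemma taylor_pderiv_expo: "taylor \<xi> (pderiv_expo g p) = pderiv_expo g (taylor \<xi> p)"
proof -
  have *: "taylor \<xi> ((pderiv_var v ^^ k) q) = (pderiv_var v ^^ k) (taylor \<xi> q)" for v k q
    by (induction k) (simp_all add: taylor_pderiv_var)
  have "taylor \<xi> (foldr (\<lambda>v. pderiv_var v ^^ lookup g v) xs p) =
    foldr (\<lambda>v. pderiv_var v ^^ lookup g v) xs (taylor \<xi> p)" for xs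
    by (induction xs) (simp_all add: *)
  then show ?thesis by (simp add: pderiv_expo_def)
qed

lemma expo_fact_neq_0 [simp]: "expo_fact g \<noteq> 0"
  by (simp add: expo_fact_def)

text \<open>Derivatives commute with translation, so they may be taken at the origin.\<close>

theorem taylor_coefficient:
  "mpoly_eval \<xi> (pderiv_expo g p) = expo_fact g * lookup (taylor \<xi> p) g"
  by (simp add: taylor_pderiv_expo lookup_pderiv_expo_0 flip: lookup_taylor_0)

section \<open>Shifted monomials and functionals\<close>

lemma shifted_monomial_value: "shifted_monomial \<xi> a = monomial_value (\<lambda>j. Var j - Const (\<xi> j)) a"
  by (simp add: shifted_monomial_def monomial_value_UNIV)

lemma shifted_monomial_simps [simp]:
  "shifted_monomial \<xi> 0 = 1" "shifted_monomial \<xi> (unit_expo j) = Var j - Const (\<xi> j)"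
  "shifted_monomial \<xi> (a + b) = shifted_monomial \<xi> a * shifted_monomial \<xi> b"
  by (simp_all add: shifted_monomial_value monomial_value_add)

text \<open>Translation turns the shifted monomials into the monomials. This makes every statement about
  \<open>(x - \<xi>)\<^sup>a\<close> one about the coefficients of the translated polynomial.\<close>

lemma taylor_shifted_monomial [simp]: "taylor \<xi> (shifted_monomial \<xi> a) = Poly_Mapping.single a 1"
proof (induction a rule: expo_induct)
  case (unit g i)
  have "Poly_Mapping.single g 1 * Var i = Poly_Mapping.single (g + unit_expo i) (1::complex)"
    by (simp add: Var_def mult_single)
  with unit show ?case by simp
qed simp

lemma taylor_expansion: "p = lincomb Const (shifted_monomial \<xi>) (taylor \<xi> p)"
proof (rule inj_taylor)
  have "taylor \<xi> (lincomb Const (shifted_monomial \<xi>) (taylor \<xi> p)) =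
      (\<Sum>m\<in>keys (taylor \<xi> p). Poly_Mapping.single m (lookup (taylor \<xi> p) m))"
    by (simp add: lincomb_def) (simp add: Const_def mult_single)
  also have "\<dots> = taylor \<xi> p"
    by (rule poly_mapping_eqI) (auto simp: lookup_sum lookup_single when_def in_keys_iff)
  finally show "taylor \<xi> p = taylor \<xi> (lincomb Const (shifted_monomial \<xi>) (taylor \<xi> p))" ..
qed

text \<open>A functional is determined by its normalized coefficients, which are its values on the
  shifted monomials.\<close>

lemma dfun_apply_lincomb: "dfun_apply \<xi> L p = lincomb id (nu_coeff L) (taylor \<xi> p)"
proof -
  let ?A = "keys L \<union> keys (taylor \<xi> p)"
  have "dfun_apply \<xi> L p = lincomb id (\<lambda>b. expo_fact b * lookup (taylor \<xi> p) b) L"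
    by (simp add: dfun_apply_def lincomb_def taylor_coefficient)
  also have "\<dots> = (\<Sum>b\<in>?A. lookup L b * (expo_fact b * lookup (taylor \<xi> p) b))"
    by (subst lincomb_superset[where A = ?A]) auto
  also have "\<dots> = lincomb id (nu_coeff L) (taylor \<xi> p)"
    by (subst lincomb_superset[where A = ?A]) (auto simp: nu_coeff_def mult_ac)
  finally show ?thesis .
qed

lemma dfun_apply_shifted_monomial [simp]: "dfun_apply \<xi> L (shifted_monomial \<xi> a) = nu_coeff L a"
  by (simp add: dfun_apply_lincomb)

lemma dfun_apply_linear [simp]:
  "dfun_apply \<xi> L 0 = 0"
  "dfun_apply \<xi> L (p + q) = dfun_apply \<xi> L p + dfun_apply \<xi> L q"
  "dfun_apply \<xi> L (Const c * p) = c * dfun_apply \<xi> L p"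
proof -
  show "dfun_apply \<xi> L (Const c * p) = c * dfun_apply \<xi> L p"
    by (simp add: dfun_apply_lincomb lincomb_Const_mult)
qed (simp_all add: dfun_apply_lincomb lincomb_add)

lemma dfun_apply_sum [simp]: "dfun_apply \<xi> L (sum f A) = (\<Sum>a\<in>A. dfun_apply \<xi> L (f a))"
  by (induction A rule: infinite_finite_induct) simp_all

lemma dfun_apply_diff [simp]: "dfun_apply \<xi> L (p - q) = dfun_apply \<xi> L p - dfun_apply \<xi> L q"
  using dfun_apply_linear(2)[of \<xi> L "p - q" q] by simp

section \<open>Coefficient rings and ideals\<close>

text \<open>Used both for the coefficient field and for the carriers of polynomial rings over it, which
  are subsets of a type with ring operations.\<close>

definition subring_set :: "'a::comm_ring_1 set \<Rightarrow> bool" where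
  "subring_set S \<longleftrightarrow> 0 \<in> S \<and> 1 \<in> S \<and> (\<forall>a\<in>S. - a \<in> S) \<and>
     (\<forall>a\<in>S. \<forall>b\<in>S. a + b \<in> S) \<and> (\<forall>a\<in>S. \<forall>b\<in>S. a * b \<in> S)"

lemma subring_setD:
  assumes "subring_set S"
  shows "0 \<in> S" "1 \<in> S" "a \<in> S \<Longrightarrow> - a \<in> S" "a \<in> S \<Longrightarrow> b \<in> S \<Longrightarrow> a + b \<in> S"
    "a \<in> S \<Longrightarrow> b \<in> S \<Longrightarrow> a * b \<in> S" "a \<in> S \<Longrightarrow> b \<in> S \<Longrightarrow> a - b \<in> S"
  using assms by (auto simp: subring_set_def simp flip: add_uminus_conv_diff)

lemma subring_set_sum: "subring_set S \<Longrightarrow> (\<And>x. x \<in> A \<Longrightarrow> f x \<in> S) \<Longrightarrow> sum f A \<in> S"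
  by (induction A rule: infinite_finite_induct) (auto simp: subring_setD)

lemma subring_set_power: "subring_set S \<Longrightarrow> a \<in> S \<Longrightarrow> a ^ k \<in> S"
  by (induction k) (auto simp: subring_setD)

lemma subring_set_prod: "subring_set S \<Longrightarrow> (\<And>x. x \<in> A \<Longrightarrow> f x \<in> S) \<Longrightarrow> prod f A \<in> S"
  by (induction A rule: infinite_finite_induct) (auto simp: subring_setD)

lemma subring_set_of_nat: "subring_set S \<Longrightarrow> of_nat k \<in> S"
  by (induction k) (auto simp: subring_setD)

lemma subring_set_UNIV [simp]: "subring_set UNIV"
  by (simp add: subring_set_def)

lemma mpoly_ring_simps [simp]:
  "mult (mpoly_ring K V) = (*)" "one (mpoly_ring K V) = 1"
  "zero (mpoly_ring K V) = 0" "add (mpoly_ring K V) = (+)" "carrier (mpoly_ring UNIV UNIV) = UNIV"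
  by (simp_all add: mpoly_ring_def)

lemma mem_mpoly_ring:
  "p \<in> carrier (mpoly_ring K V) \<longleftrightarrow> (\<forall>m. lookup p m \<in> K) \<and> (\<forall>m\<in>keys p. keys m \<subseteq> V)"
  by (auto simp: mpoly_ring_def)

lemma subring_set_mpoly_ring:
  assumes K: "subring_set K"
  shows "subring_set (carrier (mpoly_ring K V))"
proof -
  let ?C = "carrier (mpoly_ring K V)"
  have add: "p + q \<in> ?C" if "p \<in> ?C" "q \<in> ?C" for p q
    using that keys_add[of p q] subring_setD(4)[OF K]
    by (fastforce simp: mem_mpoly_ring lookup_add)
  have sum: "sum f A \<in> ?C" if "\<And>x. x \<in> A \<Longrightarrow> f x \<in> ?C" for f :: "_ \<Rightarrow> 'a mpoly" and A :: "'a expo set"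
    using that
    by (induction A rule: infinite_finite_induct)
      (auto simp: add subring_setD(1)[OF K] mem_mpoly_ring[of 0])
  have mult: "p * q \<in> ?C" if "p \<in> ?C" "q \<in> ?C" for p q
  proof -
    have e: "r = (\<Sum>m\<in>keys r. Poly_Mapping.single m (lookup r m))" for r :: "'a mpoly"
      by (rule poly_mapping_eqI) (auto simp: lookup_sum lookup_single when_def in_keys_iff)
    have "Poly_Mapping.single (m + n) (lookup p m * lookup q n) \<in> ?C" if "m \<in> keys p" "n \<in> keys q" for m n
    proof -
      have "lookup p m * lookup q n \<in> K"
        using \<open>p \<in> ?C\<close> \<open>q \<in> ?C\<close> subring_setD(5)[OF K] by (simp add: mem_mpoly_ring)
      moreover have "keys (m + n) \<subseteq> V"
        using that \<open>p \<in> ?C\<close> \<open>q \<in> ?C\<close> keys_add[of m n] unfolding mem_mpoly_ring by blast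
      ultimately show ?thesis
        using subring_setD(1)[OF K] by (auto simp: mem_mpoly_ring lookup_single when_def split: if_splits)
    qed
    then have "(\<Sum>m\<in>keys p. \<Sum>n\<in>keys q. Poly_Mapping.single (m + n) (lookup p m * lookup q n)) \<in> ?C"
      by (intro sum)
    moreover have "p * q = (\<Sum>m\<in>keys p. \<Sum>n\<in>keys q. Poly_Mapping.single (m + n) (lookup p m * lookup q n))"
      using arg_cong2[OF e[of p] e[of q], of "(*)"] by (simp only: sum_product mult_single)
    ultimately show ?thesis by simp
  qed
  have "0 \<in> ?C" "1 \<in> ?C"
    using subring_setD(1,2)[OF K] by (auto simp: mem_mpoly_ring lookup_one when_def)
  moreover have "- p \<in> ?C" if "p \<in> ?C" for p
    using that subring_setD(3)[OF K] by (simp add: mem_mpoly_ring)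
  ultimately show ?thesis
    unfolding subring_set_def using add mult by blast
qed

lemma cring_mpoly_ring:
  assumes "subring_set K"
  shows "cring (mpoly_ring K V)"
proof -
  let ?R = "mpoly_ring K V"
  note C = subring_setD[OF subring_set_mpoly_ring[OF assms, of V]]
  have "abelian_group ?R"
  proof (rule abelian_groupI)
    fix x assume "x \<in> carrier ?R"
    then show "\<exists>y\<in>carrier ?R. y \<oplus>\<^bsub>?R\<^esub> x = \<zero>\<^bsub>?R\<^esub>"
      using C(3) by (intro bexI[of _ "- x"]) auto
  qed (auto simp: C algebra_simps)
  moreover have "comm_monoid ?R"
    by (rule comm_monoidI) (auto simp: C algebra_simps)
  ultimately show ?thesis
    by (intro cringI) (auto simp: algebra_simps)
qed

lemma ideal_mpoly_ringI:
  assumes K: "subring_set K" and J: "J \<subseteq> carrier (mpoly_ring K V)"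
    and zero: "0 \<in> J" and add: "\<And>a b. a \<in> J \<Longrightarrow> b \<in> J \<Longrightarrow> a + b \<in> J"
    and mult: "\<And>a x. a \<in> J \<Longrightarrow> x \<in> carrier (mpoly_ring K V) \<Longrightarrow> x * a \<in> J"
  shows "ideal J (mpoly_ring K V)"
proof (rule idealI)
  let ?R = "mpoly_ring K V"
  interpret cring ?R by (rule cring_mpoly_ring[OF K])
  note C = subring_setD[OF subring_set_mpoly_ring[OF K, of V]]
  show "ring ?R" by (rule ring_axioms)
  have neg: "- x \<in> J" if "x \<in> J" for x
    using mult[OF that C(3)[OF C(2)]] by simp
  have "\<ominus>\<^bsub>?R\<^esub> x = - x" if "x \<in> J" for x
    using that J neg by (intro minus_equality) auto
  then show "subgroup J (add_monoid ?R)"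
    using J zero add neg by (intro add.subgroupI) auto
  show "a \<otimes>\<^bsub>?R\<^esub> x \<in> J" if "a \<in> J" "x \<in> carrier ?R" for a x
    using mult[OF that] by (simp add: mult.commute)
qed (use mult in simp)

lemma ideal_mpoly_ringD:
  assumes "ideal J (mpoly_ring K V)"
  shows "0 \<in> J" "a \<in> J \<Longrightarrow> b \<in> J \<Longrightarrow> a + b \<in> J"
    "a \<in> J \<Longrightarrow> x \<in> carrier (mpoly_ring K V) \<Longrightarrow> x * a \<in> J" "J \<subseteq> carrier (mpoly_ring K V)"
proof -
  interpret ideal J "mpoly_ring K V" by fact
  show "0 \<in> J" using additive_subgroup.zero_closed[OF is_additive_subgroup] by simp
  show "a \<in> J \<Longrightarrow> b \<in> J \<Longrightarrow> a + b \<in> J" using additive_subgroup.a_closed[OF is_additive_subgroup] by simp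
  show "a \<in> J \<Longrightarrow> x \<in> carrier (mpoly_ring K V) \<Longrightarrow> x * a \<in> J" using I_l_closed by simp
  show "J \<subseteq> carrier (mpoly_ring K V)" by (rule a_subset)
qed

lemma genideal_leI: "ideal J R \<Longrightarrow> S \<subseteq> J \<Longrightarrow> genideal R S \<subseteq> J"
  unfolding genideal_def by blast

lemma subset_genideal: "S \<subseteq> genideal R S"
  unfolding genideal_def by blast

lemma subring_set_subfield:
  assumes "subfield K complex_ring"
  shows "subring_set K" "a \<in> K \<Longrightarrow> inverse a \<in> K"
proof -
  interpret subfield K complex_ring by fact
  note [simp] = complex_ring_def
  have inv_add: "inv\<^bsub>add_monoid complex_ring\<^esub> x = - x" for x
    unfolding m_inv_def by (rule the_equality) (auto dest: minus_unique)
  have "- x \<in> K" if "x \<in> K" for x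
    using m_inv_closed[OF that] unfolding inv_add .
  moreover have "0 \<in> K" "1 \<in> K" using subgroup.one_closed[OF subgroup_axioms] submonoid.one_closed[OF subring.axioms(2)[OF subring_axioms]] by auto
  moreover have "x + y \<in> K" "x * y \<in> K" if "x \<in> K" "y \<in> K" for x y
    using subgroup.m_closed[OF subgroup_axioms that]
      submonoid.m_closed[OF subring.axioms(2)[OF subring_axioms] that] by simp_all
  ultimately show *: "subring_set K" by (auto simp: subring_set_def)
  show "inverse a \<in> K" if "a \<in> K"
  proof (cases "a = 0")
    case False
    then have "a \<in> Units (complex_ring\<lparr>carrier := K\<rparr>)"
      using that subfield_Units by simp
    then obtain x where "x \<in> K" "x * a = 1" by (auto simp: Units_def)
    then show ?thesis using False by (metis inverse_unique mult.commute)
  qed (use that in simp)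
qed

section \<open>Exponents\<close>

lemma expo_deg_simps [simp]:
  "expo_deg (0 :: 'n::finite expo) = 0" "expo_deg (unit_expo i :: 'n expo) = 1"
  "expo_deg (a + b :: 'n expo) = expo_deg a + expo_deg b"
  by (simp_all add: expo_deg_def unit_expo_def lookup_single when_def lookup_add sum.distrib)

lemma expo_deg_eq_0 [simp]: "expo_deg (a :: 'n::finite expo) = 0 \<longleftrightarrow> a = 0"
  by (simp add: expo_deg_def poly_mapping_eq_iff fun_eq_iff)

lemma finite_expo_deg_le: "finite {g :: 'n::finite expo. expo_deg g \<le> n}"
proof (rule finite_subset)
  have "lookup g v \<le> n" if "expo_deg g \<le> n" for g :: "'n expo" and v
    using that member_le_sum[of v UNIV "lookup g"] by (simp add: expo_deg_def)
  then show "{g :: 'n expo. expo_deg g \<le> n} \<subseteq> lookup -` (PiE UNIV (\<lambda>_. {..n}))"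
    by (auto simp: PiE_UNIV_domain)
  show "finite (lookup -` (PiE UNIV (\<lambda>_ :: 'n. {..n})))"
    by (intro finite_vimageI finite_PiE) (auto intro!: injI poly_mapping_eqI)
qed

text \<open>Hence only finitely many derivatives of \<open>p\<close> are non-zero.\<close>

lemma keys_pderiv_expo_deg:
  assumes "\<And>m. m \<in> keys p \<Longrightarrow> expo_deg m \<le> n" and "m \<in> keys (pderiv_expo g p)"
  shows "expo_deg m + expo_deg g \<le> n"
proof -
  have 1: "expo_deg m + k \<le> n'" if "\<And>m. m \<in> keys q \<Longrightarrow> expo_deg m \<le> n'" "m \<in> keys ((pderiv_var v ^^ k) q)"
    for q :: "'a mpoly" and m k v n'
    using that(2)
  proof (induction k arbitrary: m)
    case (Suc k)
    then have "m + unit_expo v \<in> keys ((pderiv_var v ^^ k) q)"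
      by (simp add: in_keys_iff lookup_pderiv_var)
    from Suc.IH[OF this] show ?case by simp
  qed (use that in auto)
  have "expo_deg m + (\<Sum>v\<in>set xs. lookup g v) \<le> n"
    if "distinct xs" "m \<in> keys (foldr (\<lambda>v. pderiv_var v ^^ lookup g v) xs p)" for xs m
    using that
  proof (induction xs arbitrary: m)
    case (Cons v xs)
    let ?q = "foldr (\<lambda>v. pderiv_var v ^^ lookup g v) xs p" and ?s = "\<Sum>v\<in>set xs. lookup g v"
    have "expo_deg m' + ?s \<le> n" if "m' \<in> keys ?q" for m'
      using Cons that by simp
    then have *: "?s \<le> n \<and> expo_deg m' \<le> n - ?s" if "m' \<in> keys ?q" for m'
      using that by fastforce
    then have "expo_deg m + lookup g v \<le> n - ?s"
      using Cons.prems(2) by (intro 1) auto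
    moreover have "?q \<noteq> 0"
    proof
      assume z: "?q = 0"
      have "(pderiv_var v ^^ k) 0 = (0 :: 'a mpoly)" for k
        by (induction k) (simp_all add: pderiv_var_lincomb)
      then show False using Cons.prems(2) z by simp
    qed
    then have "keys ?q \<noteq> {}" by simp
    then have "?s \<le> n" using * by blast
    ultimately show ?case using Cons.prems(1) by simp
  qed (use assms in auto)
  from this[of "sorted_list_of_set UNIV"] show ?thesis
    using assms(2) by (simp add: pderiv_expo_def expo_deg_def)
qed

section \<open>The parametric multiplication matrices at a point\<close>

lemma sum_mult_indicator [simp]:
  fixes f :: "nat \<Rightarrow> 'a::comm_ring_1"
  shows "(\<Sum>k<n. f k * (if k = j then 1 else 0)) = (if j < n then f j else 0)"
    and "(\<Sum>k<n. f k * (if j = k then 1 else 0)) = (if j < n then f j else 0)"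
proof -
  have "(\<Sum>k<n. f k * (if k = j then 1 else 0)) = (\<Sum>k<n. if k = j then f k else 0)"
    by (intro sum.cong) auto
  then show "(\<Sum>k<n. f k * (if k = j then 1 else 0)) = (if j < n then f j else 0)" by simp
  then show "(\<Sum>k<n. f k * (if j = k then 1 else 0)) = (if j < n then f j else 0)"
    by (simp add: eq_commute[of j])
qed

locale lower_exponents =
  fixes \<alpha> :: "nat \<Rightarrow> 'n::{finite,linorder} expo" and \<delta> :: nat
  assumes pos: "0 < \<delta>" and inj: "inj_on \<alpha> {..<\<delta>}"
    and stable: "stable_under_subtraction (exponents \<alpha> \<delta>)"
    and alpha_0: "\<alpha> 0 = 0"
    and deg_mono: "\<And>i j. i \<le> j \<Longrightarrow> j < \<delta> \<Longrightarrow> expo_deg (\<alpha> i) \<le> expo_deg (\<alpha> j)"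
begin

text \<open>The entry in row \<open>l\<close>, column \<open>k\<close> of \<open>M\<^sub>i(\<nu>)\<close>.\<close>

definition mat_entry :: "('n expo \<times> 'n expo \<Rightarrow> complex) \<Rightarrow> 'n \<Rightarrow> nat \<Rightarrow> nat \<Rightarrow> complex" where
  "mat_entry \<nu> i l k =
     (if \<alpha> l = \<alpha> k + unit_expo i then 1
      else if \<alpha> k + unit_expo i \<notin> exponents \<alpha> \<delta> \<and> expo_deg (\<alpha> l) \<ge> expo_deg (\<alpha> k) + 1
        then \<nu> (\<alpha> l, \<alpha> k + unit_expo i)
      else 0)"

text \<open>\<open>b g\<close> is the vector \<open>M\<^sup>g[1]\<close>, whatever the order of the factors: the recursion holds for all
  \<open>i\<close>, so it forces the matrices to commute (\<open>moments_commuting\<close> below). The values at indices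
  \<open>\<ge> \<delta>\<close> are arbitrary.\<close>

definition moments :: "('n expo \<times> 'n expo \<Rightarrow> complex) \<Rightarrow> ('n expo \<Rightarrow> nat \<Rightarrow> complex) \<Rightarrow> bool" where
  "moments \<nu> b \<longleftrightarrow> (\<forall>l<\<delta>. b 0 l = (if l = 0 then 1 else 0)) \<and>
     (\<forall>g i. \<forall>l<\<delta>. b (g + unit_expo i) l = (\<Sum>k<\<delta>. mat_entry \<nu> i l k * b g k))"

lemma moments_0: "moments \<nu> b \<Longrightarrow> l < \<delta> \<Longrightarrow> b 0 l = (if l = 0 then 1 else 0)"
  by (simp add: moments_def)

lemma moments_step:
  "moments \<nu> b \<Longrightarrow> l < \<delta> \<Longrightarrow> b (g + unit_expo i) l = (\<Sum>k<\<delta>. mat_entry \<nu> i l k * b g k)"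
  by (simp add: moments_def)

lemma alpha_eq_iff: "k < \<delta> \<Longrightarrow> l < \<delta> \<Longrightarrow> \<alpha> k = \<alpha> l \<longleftrightarrow> k = l"
  using inj by (auto dest: inj_onD)

lemma exponents_predecessor:
  assumes "g + h \<in> exponents \<alpha> \<delta>"
  obtains j where "j < \<delta>" "g = \<alpha> j"
proof -
  have "g \<in> exponents \<alpha> \<delta>"
    using stable[unfolded stable_under_subtraction_def, rule_format, OF assms, of g]
    by (simp add: lookup_add)
  then show ?thesis using that by auto
qed

lemma mat_entry_deg: "mat_entry \<nu> i l k \<noteq> 0 \<Longrightarrow> expo_deg (\<alpha> k) + 1 \<le> expo_deg (\<alpha> l)"
  by (auto simp: mat_entry_def split: if_splits)

text \<open>Each \<open>M\<^sub>i\<close> maps a basis vector to vectors of larger degree.\<close>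

lemma moments_deg:
  assumes "moments \<nu> b" "l < \<delta>" "expo_deg (\<alpha> l) < expo_deg g"
  shows "b g l = 0"
  using assms(2,3)
proof (induction g arbitrary: l rule: expo_induct)
  case (unit g i)
  have "mat_entry \<nu> i l k * b g k = 0" if "k < \<delta>" for k
    using unit.IH[of k] unit.prems mat_entry_deg[of \<nu> i l k] that
    by (cases "mat_entry \<nu> i l k = 0") auto
  then show ?case
    unfolding moments_step[OF assms(1) unit.prems(1)] by (intro sum.neutral) auto
qed simp

text \<open>This is where stability under subtraction is used: removing \<open>e\<^sub>i\<close> from \<open>\<alpha> k\<close> leads to another element of
  \<open>E\<close>, from which the entry 1 of \<open>M\<^sub>i\<close> leads back.\<close>

lemma moments_basis:
  assumes "moments \<nu> b" "k < \<delta>" "l < \<delta>"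
  shows "b (\<alpha> k) l = (if l = k then 1 else 0)"
proof -
  have "\<alpha> k = g \<Longrightarrow> b g l = (if l = k then 1 else 0)" for g
    using assms(2,3)
  proof (induction g arbitrary: k l rule: expo_induct)
    case zero
    then have "k = 0" using alpha_0 alpha_eq_iff[of k 0] pos by simp
    then show ?case using zero moments_0[OF assms(1)] by simp
  next
    case (unit g i)
    have ge: "g + unit_expo i \<in> exponents \<alpha> \<delta>" using unit.prems by force
    then obtain j where j: "j < \<delta>" "g = \<alpha> j" by (rule exponents_predecessor)
    have "b (g + unit_expo i) l = (\<Sum>m<\<delta>. mat_entry \<nu> i l m * (if m = j then 1 else 0))"
      unfolding moments_step[OF assms(1) unit.prems(3)]
      using unit.IH[OF j(2)[symmetric] j(1)] by (intro sum.cong) auto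
    also have "\<dots> = mat_entry \<nu> i l j" using j(1) by simp
    also have "\<dots> = (if l = k then 1 else 0)"
      using ge j(2) unit.prems alpha_eq_iff[of l k] by (auto simp: mat_entry_def)
    finally show ?case .
  qed
  then show ?thesis by simp
qed

text \<open>The matrices can be read off from the moments. So an equation between products of matrices
  becomes an equation between moments.\<close>

lemma moments_mat_entry:
  assumes "moments \<nu> b" "k < \<delta>" "l < \<delta>"
  shows "b (\<alpha> k + unit_expo i) l = mat_entry \<nu> i l k"
proof -
  have "b (\<alpha> k + unit_expo i) l = (\<Sum>m<\<delta>. mat_entry \<nu> i l m * (if m = k then 1 else 0))"
    unfolding moments_step[OF assms(1,3)]
    using moments_basis[OF assms(1,2)] by (intro sum.cong) auto
  then show ?thesis using assms(2) by simp
qed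

lemma moments_unique:
  assumes "moments \<nu> b" "moments \<nu> b'" "l < \<delta>"
  shows "b g l = b' g l"
  using assms(3)
proof (induction g arbitrary: l rule: expo_induct)
  case zero
  then show ?case by (simp add: moments_0[OF assms(1)] moments_0[OF assms(2)])
next
  case (unit g i)
  then show ?case by (simp add: moments_step[OF assms(1)] moments_step[OF assms(2)])
qed

text \<open>As \<open>b g\<close> is the combination of the \<open>b (\<alpha> k)\<close> with the coefficients \<open>b g k\<close>, the product
  \<open>M\<^sup>h\<close> acts on it through the \<open>b (\<alpha> k + h)\<close>.\<close>

lemma moments_add:
  assumes "moments \<nu> b" "l < \<delta>"
  shows "b (g + h) l = (\<Sum>k<\<delta>. b g k * b (\<alpha> k + h) l)"
  using assms(2)
proof (induction h arbitrary: l rule: expo_induct)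
  case zero
  then have "(\<Sum>k<\<delta>. b g k * b (\<alpha> k + 0) l) = (\<Sum>k<\<delta>. b g k * (if l = k then 1 else 0))"
    by (intro sum.cong) (auto simp: moments_basis[OF assms(1)])
  then show ?case using zero by simp
next
  case (unit h i)
  have "b (g + (h + unit_expo i)) l = (\<Sum>m<\<delta>. \<Sum>k<\<delta>. mat_entry \<nu> i l m * (b g k * b (\<alpha> k + h) m))"
    using moments_step[OF assms(1) unit.prems, of "g + h" i]
    by (simp add: add.assoc unit.IH sum_distrib_left)
  also have "\<dots> = (\<Sum>k<\<delta>. \<Sum>m<\<delta>. mat_entry \<nu> i l m * (b g k * b (\<alpha> k + h) m))"
    by (rule sum.swap)
  also have "\<dots> = (\<Sum>k<\<delta>. b g k * b (\<alpha> k + (h + unit_expo i)) l)"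
    using moments_step[OF assms(1) unit.prems, of "\<alpha> _ + h" i]
    by (simp add: add.assoc sum_distrib_left mult.left_commute)
  finally show ?case .
qed

definition commuting :: "('n expo \<times> 'n expo \<Rightarrow> complex) \<Rightarrow> bool" where
  "commuting \<nu> \<longleftrightarrow> (\<forall>i j. \<forall>l<\<delta>. \<forall>k<\<delta>.
     (\<Sum>m<\<delta>. mat_entry \<nu> i l m * mat_entry \<nu> j m k) = (\<Sum>m<\<delta>. mat_entry \<nu> j l m * mat_entry \<nu> i m k))"

text \<open>Both products send \<open>e\<^sub>k\<close> to \<open>b (\<alpha> k + e\<^sub>i + e\<^sub>j)\<close>.\<close>

lemma moments_commuting:
  assumes "moments \<nu> b"
  shows "commuting \<nu>"
proof -
  have "(\<Sum>m<\<delta>. mat_entry \<nu> i l m * mat_entry \<nu> j m k) = b (\<alpha> k + unit_expo j + unit_expo i) l"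
    if "l < \<delta>" "k < \<delta>" for i j l k
    unfolding moments_step[OF assms that(1)]
    using that by (intro sum.cong) (auto simp: moments_mat_entry[OF assms])
  then show ?thesis by (simp add: commuting_def add_ac)
qed

text \<open>The matrix \<open>M\<^sub>i(\<nu>)\<close> as an operator. Its value is cut off to 0 from index \<open>\<delta>\<close> on, so that commuting
  matrices give operators that commute as functions.\<close>

definition mat_apply :: "('n expo \<times> 'n expo \<Rightarrow> complex) \<Rightarrow> 'n \<Rightarrow> (nat \<Rightarrow> complex) \<Rightarrow> nat \<Rightarrow> complex" where
  "mat_apply \<nu> i w = (\<lambda>l. if l < \<delta> then \<Sum>k<\<delta>. mat_entry \<nu> i l k * w k else 0)"

text \<open>\<open>M(\<nu>)\<^sup>g[1]\<close> with the factors in the order of the deflated ideal, defined also if the matrices do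
  not commute.\<close>

definition ordered_moments :: "('n expo \<times> 'n expo \<Rightarrow> complex) \<Rightarrow> 'n expo \<Rightarrow> nat \<Rightarrow> complex" where
  "ordered_moments \<nu> g = foldr (\<lambda>i. mat_apply \<nu> i ^^ lookup g i) (sorted_list_of_set UNIV)
     (\<lambda>l. if l = 0 then 1 else 0)"

lemma mat_apply_commute:
  assumes "commuting \<nu>"
  shows "mat_apply \<nu> i (mat_apply \<nu> j w) = mat_apply \<nu> j (mat_apply \<nu> i w)"
proof -
  have e: "mat_apply \<nu> i (mat_apply \<nu> j w) l = (\<Sum>k<\<delta>. (\<Sum>m<\<delta>. mat_entry \<nu> i l m * mat_entry \<nu> j m k) * w k)"
    if "l < \<delta>" for i j l
    using that
    by (simp add: mat_apply_def sum_distrib_left sum_distrib_right mult.assoc) (rule sum.swap)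
  have "mat_apply \<nu> i (mat_apply \<nu> j w) l = mat_apply \<nu> j (mat_apply \<nu> i w) l" for l
  proof (cases "l < \<delta>")
    case True
    then show ?thesis using assms unfolding e[OF True] commuting_def by simp
  qed (simp add: mat_apply_def)
  then show ?thesis by blast
qed

lemma moments_ordered_moments:
  assumes "commuting \<nu>"
  shows "moments \<nu> (ordered_moments \<nu>)"
proof -
  let ?F = "\<lambda>g xs w. foldr (\<lambda>i. mat_apply \<nu> i ^^ lookup g i) xs w"
  have pow: "mat_apply \<nu> i ((mat_apply \<nu> j ^^ k) w) = (mat_apply \<nu> j ^^ k) (mat_apply \<nu> i w)" for i j k w
    by (induction k) (simp_all add: mat_apply_commute[OF assms, of i j])
  have "?F (g + unit_expo i) xs w = (if i \<in> set xs then mat_apply \<nu> i (?F g xs w) else ?F g xs w)"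
    if "distinct xs" for g i xs w
    using that
    by (induction xs) (auto simp: lookup_add unit_expo_def lookup_single when_def pow)
  then have "ordered_moments \<nu> (g + unit_expo i) = mat_apply \<nu> i (ordered_moments \<nu> g)" for g i
    by (simp add: ordered_moments_def)
  moreover have "ordered_moments \<nu> 0 = (\<lambda>l. if l = 0 then 1 else 0)"
  proof -
    have "?F 0 xs w = w" for xs w by (induction xs) simp_all
    then show ?thesis by (simp add: ordered_moments_def)
  qed
  ultimately show ?thesis by (simp add: moments_def mat_apply_def)
qed

lemma moments_eq_ordered_moments:
  "moments \<nu> b \<Longrightarrow> l < \<delta> \<Longrightarrow> b g l = ordered_moments \<nu> g l"
  using moments_unique moments_commuting moments_ordered_moments by blast

section \<open>Evaluation of the parametric normal form\<close>

lemma mult_mat_carrier [simp]: "mult_mat \<alpha> \<delta> i \<in> carrier_mat \<delta> \<delta>"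
  by (simp add: mult_mat_def)

lemma mult_mat_dim [simp]: "dim_row (mult_mat \<alpha> \<delta> i) = \<delta>" "dim_col (mult_mat \<alpha> \<delta> i) = \<delta>"
  by (simp_all add: mult_mat_def)

lemma mult_mat_index:
  assumes "l < \<delta>" "k < \<delta>"
  shows "mult_mat \<alpha> \<delta> i $$ (l, k) =
    (if \<alpha> l = \<alpha> k + unit_expo i then 1
     else if \<alpha> k + unit_expo i \<notin> exponents \<alpha> \<delta> \<and> expo_deg (\<alpha> l) \<ge> expo_deg (\<alpha> k) + 1
       then Var (Mu (\<alpha> l, \<alpha> k + unit_expo i))
     else 0)"
  using assms by (simp add: mult_mat_def)

lemma eval_mult_mat:
  "l < \<delta> \<Longrightarrow> k < \<delta> \<Longrightarrow> mpoly_eval (case_dvar \<xi> \<nu>) (mult_mat \<alpha> \<delta> i $$ (l, k)) = mat_entry \<nu> i l k"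
  by (simp add: mult_mat_index mat_entry_def)

text \<open>The vectors \<open>M(\<mu>)\<^sup>g[1]\<close> arise from \<open>[1]\<close> by applying parametric matrices one at a time. The rule
  is used for the value of these vectors at a point and for the ring that contains their entries.\<close>

lemma mult_mat_expo_vec_induct:
  assumes base: "P (unit_vec \<delta> 0) (\<lambda>l. if l = 0 then 1 else 0)"
    and step: "\<And>i w c. w \<in> carrier_vec \<delta> \<Longrightarrow> P w c \<Longrightarrow> P (mult_mat \<alpha> \<delta> i *\<^sub>v w) (mat_apply \<nu> i c)"
  shows "P (mult_mat_expo \<alpha> \<delta> g *\<^sub>v unit_vec \<delta> 0) (ordered_moments \<nu> g)"
proof -
  let ?A = "\<lambda>i. mult_mat \<alpha> \<delta> i"
  have pow: "P (?A i ^\<^sub>m k *\<^sub>v w) ((mat_apply \<nu> i ^^ k) c)" if "w \<in> carrier_vec \<delta>" "P w c" for i k w c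
    using that
  proof (induction k arbitrary: w c)
    case (Suc k)
    have "?A i ^\<^sub>m Suc k *\<^sub>v w = ?A i ^\<^sub>m k *\<^sub>v (?A i *\<^sub>v w)"
      using Suc.prems by (simp add: assoc_mult_mat_vec[OF pow_carrier_mat mult_mat_carrier])
    moreover have "(mat_apply \<nu> i ^^ Suc k) c = (mat_apply \<nu> i ^^ k) (mat_apply \<nu> i c)"
      by (simp add: funpow_swap1)
    ultimately show ?case
      using Suc.IH[of "?A i *\<^sub>v w" "mat_apply \<nu> i c"] step Suc.prems mult_mat_vec_carrier[OF mult_mat_carrier]
      by metis
  qed simp
  define F where "F = (\<lambda>xs. foldr (\<lambda>i A. ?A i ^\<^sub>m lookup g i * A) xs (1\<^sub>m \<delta>))"
  have carrier: "F xs \<in> carrier_mat \<delta> \<delta>" for xs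
    by (induction xs) (auto simp: F_def intro!: mult_carrier_mat pow_carrier_mat)
  have "P (F xs *\<^sub>v unit_vec \<delta> 0) (foldr (\<lambda>i. mat_apply \<nu> i ^^ lookup g i) xs (\<lambda>l. if l = 0 then 1 else 0))" for xs
  proof (induction xs)
    case Nil
    then show ?case using base by (simp add: F_def)
  next
    case (Cons i xs)
    have "F (i # xs) *\<^sub>v unit_vec \<delta> 0 = ?A i ^\<^sub>m lookup g i *\<^sub>v (F xs *\<^sub>v unit_vec \<delta> 0)"
      using assoc_mult_mat_vec[OF pow_carrier_mat[OF mult_mat_carrier] carrier, of "unit_vec \<delta> 0"]
      by (simp add: F_def)
    then show ?case using pow[OF _ Cons] mult_mat_vec_carrier[OF carrier] by simp
  qed
  then show ?thesis by (simp add: mult_mat_expo_def ordered_moments_def F_def)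
qed

lemma mult_mat_vec_index:
  assumes "w \<in> carrier_vec \<delta>" "l < \<delta>"
  shows "(mult_mat \<alpha> \<delta> i *\<^sub>v w) $ l = (\<Sum>k<\<delta>. mult_mat \<alpha> \<delta> i $$ (l, k) * w $ k)"
  using assms
  by (auto simp: scalar_prod_def carrier_vecD lessThan_atLeast0 intro!: sum.cong)

lemma eval_mult_mat_expo:
  assumes "l < \<delta>"
  shows "mpoly_eval (case_dvar \<xi> \<nu>) ((mult_mat_expo \<alpha> \<delta> g *\<^sub>v unit_vec \<delta> 0) $ l) = ordered_moments \<nu> g l"
proof -
  define P where "P w c \<longleftrightarrow> (\<forall>l<\<delta>. mpoly_eval (case_dvar \<xi> \<nu>) (w $ l) = c l)" for w c
  have "P (mult_mat_expo \<alpha> \<delta> g *\<^sub>v unit_vec \<delta> 0) (ordered_moments \<nu> g)"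
  proof (rule mult_mat_expo_vec_induct)
    show "P (unit_vec \<delta> 0) (\<lambda>l. if l = 0 then 1 else 0)"
      by (simp add: P_def unit_vec_def)
    show "P (mult_mat \<alpha> \<delta> i *\<^sub>v w) (mat_apply \<nu> i c)" if "w \<in> carrier_vec \<delta>" "P w c" for i w c
      using that by (simp add: P_def mult_mat_vec_index eval_mult_mat mat_apply_def del: index_mult_mat_vec)
  qed
  then show ?thesis using assms by (simp add: P_def)
qed

text \<open>The normal form as a function of the translated polynomial \<open>taylor \<xi> p\<close>.\<close>

definition nf :: "('n expo \<Rightarrow> nat \<Rightarrow> complex) \<Rightarrow> 'n mpoly \<Rightarrow> nat \<Rightarrow> complex" where
  "nf b p l = lincomb id (\<lambda>g. b g l) p"

lemma eval_param_normal_form: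
  assumes "l < \<delta>"
  shows "mpoly_eval (case_dvar \<xi> \<nu>) (param_normal_form \<alpha> \<delta> p $ l) = nf (ordered_moments \<nu>) (taylor \<xi> p) l"
proof -
  define F where "F g = Const (1 / expo_fact g) * mpoly_subst Const (\<lambda>j. Var (X j)) (pderiv_expo g p) *
       (mult_mat_expo \<alpha> \<delta> g *\<^sub>v unit_vec \<delta> 0) $ l" for g
  \<comment> \<open>One finite range of summation for both sides: the derivatives beyond it vanish, and so do the
    Taylor coefficients.\<close>
  define n where "n = Max (expo_deg ` (keys p \<union> keys (taylor \<xi> p)))"
  have n: "expo_deg m \<le> n" if "m \<in> keys p \<union> keys (taylor \<xi> p)" for m
    using that unfolding n_def by (intro Max_ge) auto
  let ?A = "{g :: 'n expo. expo_deg g \<le> n}"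
  have "pderiv_expo g p = 0" if "\<not> expo_deg g \<le> n" for g
  proof (rule ccontr)
    assume "pderiv_expo g p \<noteq> 0"
    then have "keys (pderiv_expo g p) \<noteq> {}" by simp
    then obtain m where "m \<in> keys (pderiv_expo g p)" by blast
    then have "expo_deg m + expo_deg g \<le> n" using keys_pderiv_expo_deg n by blast
    then show False using that by simp
  qed
  then have "F g = 0" if "\<not> expo_deg g \<le> n" for g
    using that by (simp add: F_def)
  then have "Sum_any F = sum F ?A"
    by (intro Sum_any.expand_superset finite_expo_deg_le) blast
  then have "mpoly_eval (case_dvar \<xi> \<nu>) (param_normal_form \<alpha> \<delta> p $ l) =
      (\<Sum>g\<in>?A. mpoly_eval (case_dvar \<xi> \<nu>) (F g))"
    using assms by (simp add: param_normal_form_def F_def [abs_def])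
  also have "\<dots> = (\<Sum>g\<in>?A. lookup (taylor \<xi> p) g * ordered_moments \<nu> g l)"
    using assms by (intro sum.cong) (simp_all add: F_def taylor_coefficient eval_mult_mat_expo)
  also have "\<dots> = nf (ordered_moments \<nu>) (taylor \<xi> p) l"
    unfolding nf_def using n finite_expo_deg_le[of n] by (subst lincomb_superset[where A = ?A]) auto
  finally show ?thesis .
qed

lemma eval_commutator:
  assumes "k < \<delta>" "l < \<delta>"
  shows "mpoly_eval (case_dvar \<xi> \<nu>)
      ((mult_mat \<alpha> \<delta> i * mult_mat \<alpha> \<delta> j - mult_mat \<alpha> \<delta> j * mult_mat \<alpha> \<delta> i) $$ (k, l)) =
    (\<Sum>m<\<delta>. mat_entry \<nu> i k m * mat_entry \<nu> j m l) - (\<Sum>m<\<delta>. mat_entry \<nu> j k m * mat_entry \<nu> i m l)"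
proof -
  have "(mult_mat \<alpha> \<delta> i * mult_mat \<alpha> \<delta> j) $$ (k, l) =
      (\<Sum>m<\<delta>. mult_mat \<alpha> \<delta> i $$ (k, m) * mult_mat \<alpha> \<delta> j $$ (m, l))" for i j
    using assms
    by (auto simp: scalar_prod_def lessThan_atLeast0 intro!: sum.cong)
  then show ?thesis
    using assms by (simp add: eval_mult_mat)
qed

end

section \<open>Solutions of the deflated ideal\<close>

context lower_exponents
begin

lemma mult_mat_expo_in_subring:
  assumes C: "subring_set C" and M: "\<And>i l k. l < \<delta> \<Longrightarrow> k < \<delta> \<Longrightarrow> mult_mat \<alpha> \<delta> i $$ (l, k) \<in> C"
    and "l < \<delta>"
  shows "(mult_mat_expo \<alpha> \<delta> g *\<^sub>v unit_vec \<delta> 0) $ l \<in> C"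
proof -
  define P where "P w c \<longleftrightarrow> (\<forall>l<\<delta>. w $ l \<in> C)" for w and c :: "nat \<Rightarrow> complex"
  have "P (mult_mat_expo \<alpha> \<delta> g *\<^sub>v unit_vec \<delta> 0) (ordered_moments undefined g)"
  proof (rule mult_mat_expo_vec_induct)
    show "P (unit_vec \<delta> 0) (\<lambda>l. if l = 0 then 1 else 0)"
      using subring_setD(1,2)[OF C] by (simp add: P_def unit_vec_def)
    show "P (mult_mat \<alpha> \<delta> i *\<^sub>v w) (mat_apply undefined i c)" if "w \<in> carrier_vec \<delta>" "P w c" for i w c
      using that M
      by (auto simp: P_def mult_mat_vec_index simp del: index_mult_mat_vec
          intro!: subring_set_sum[OF C] subring_setD(5)[OF C])
  qed
  then show ?thesis using assms(3) by (simp add: P_def)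
qed

lemma lookup_pderiv_expo_in_subring:
  assumes K: "subring_set K" and p: "\<And>m. lookup p m \<in> K"
  shows "lookup (pderiv_expo g p) m \<in> K"
proof -
  have 1: "lookup ((pderiv_var v ^^ k) q) m \<in> K" if "\<And>m. lookup q m \<in> K" for v k q m
  proof (induction k arbitrary: m)
    case (Suc k)
    then show ?case
      using subring_setD(5)[OF K subring_set_of_nat[OF K]] by (simp add: lookup_pderiv_var del: of_nat_Suc)
  qed (simp add: that)
  have "lookup (foldr (\<lambda>v. pderiv_var v ^^ lookup g v) xs p) m \<in> K" for xs m
    by (induction xs arbitrary: m) (simp_all add: p 1)
  then show ?thesis by (simp add: pderiv_expo_def)
qed

text \<open>Needed to conclude that the whole deflated ideal vanishes where its generators do: the zeros of a
  polynomial ideal are compared inside this ring. The factors \<open>1 / \<gamma>!\<close> are in \<open>K\<close> because \<open>K\<close> is a field.\<close>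

lemma generators_in_deflated_ring:
  assumes K: "subfield K complex_ring" and f: "f ` {..<N} \<subseteq> carrier (mpoly_ring K UNIV)"
  shows "{param_normal_form \<alpha> \<delta> (f k) $ i | k i. k < N \<and> i < \<delta>} \<union>
      {(mult_mat \<alpha> \<delta> i * mult_mat \<alpha> \<delta> j - mult_mat \<alpha> \<delta> j * mult_mat \<alpha> \<delta> i) $$ (k, l) | i j k l.
         k < \<delta> \<and> l < \<delta>} \<subseteq> carrier (deflated_ring K \<alpha> \<delta>)"
proof -
  define C where "C = carrier (deflated_ring K \<alpha> \<delta>)"
  note K' = subring_set_subfield[OF K]
  have C: "subring_set C"
    unfolding C_def deflated_ring_def by (rule subring_set_mpoly_ring[OF K'(1)])
  have Const: "Const c \<in> C" if "c \<in> K" for c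
    using that subring_setD(1)[OF K'(1)]
    by (auto simp: C_def deflated_ring_def mem_mpoly_ring lookup_Const in_keys_iff split: if_splits)
  have Var: "Var v \<in> C" if "v \<in> range X \<union> Mu ` mu_index \<alpha> \<delta>" for v
    using that subring_setD(1,2)[OF K'(1)]
    by (auto simp: C_def deflated_ring_def mem_mpoly_ring Var_def unit_expo_def lookup_single when_def)
  have M: "mult_mat \<alpha> \<delta> i $$ (l, k) \<in> C" if "l < \<delta>" "k < \<delta>" for i l k
  proof -
    have "(\<alpha> l, \<alpha> k + unit_expo i) \<in> mu_index \<alpha> \<delta>"
      if "\<alpha> k + unit_expo i \<notin> exponents \<alpha> \<delta>" "expo_deg (\<alpha> l) \<ge> expo_deg (\<alpha> k) + 1"
      using that \<open>l < \<delta>\<close> \<open>k < \<delta>\<close> unfolding mu_index_def by blast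
    then show ?thesis
      unfolding mult_mat_index[OF that] using subring_setD(1,2)[OF C] Var by simp
  qed
  have "param_normal_form \<alpha> \<delta> (f k) $ l \<in> C" if "k < N" "l < \<delta>" for k l
  proof -
    have fk: "f k \<in> carrier (mpoly_ring K UNIV)" using f that(1) by auto
    have "1 / expo_fact g \<in> K" for g :: "'n expo"
    proof -
      have "expo_fact g = of_nat (\<Prod>j\<in>UNIV. fact (lookup g j))"
        by (simp add: expo_fact_def)
      then have "expo_fact g \<in> K" by (metis subring_set_of_nat[OF K'(1)])
      then show ?thesis using K'(2) by (simp add: divide_inverse)
    qed
    moreover have "mpoly_subst Const (\<lambda>j. Var (X j)) (pderiv_expo g (f k)) \<in> C" for g
      unfolding mpoly_subst_def
      using fk lookup_pderiv_expo_in_subring[OF K'(1), of "f k"]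
      by (intro subring_set_sum[OF C] subring_setD(5)[OF C] subring_set_prod[OF C] subring_set_power[OF C]
          Const Var) (auto simp: mem_mpoly_ring)
    ultimately show ?thesis
      using that mult_mat_expo_in_subring[OF C M]
      by (simp add: param_normal_form_def Sum_any.expand_set)
        (intro subring_set_sum[OF C] subring_setD(5)[OF C] Const; simp)
  qed
  moreover have "(mult_mat \<alpha> \<delta> i * mult_mat \<alpha> \<delta> j - mult_mat \<alpha> \<delta> j * mult_mat \<alpha> \<delta> i) $$ (k, l) \<in> C"
    if "k < \<delta>" "l < \<delta>" for i j k l
    using that M
    by (auto simp: scalar_prod_def intro!: subring_setD(6)[OF C] subring_set_sum[OF C] subring_setD(5)[OF C])
  ultimately show ?thesis unfolding C_def by auto
qed

text \<open>The commutator relations hold at \<open>(\<xi>, \<nu>)\<close> if and only if there is a family of moments, and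
  it then consists of the vectors that occur in the normal form.\<close>

theorem deflated_solutions_iff:
  assumes K: "subfield K complex_ring" and f: "f ` {..<N} \<subseteq> carrier (mpoly_ring K UNIV)"
  shows "(\<xi>, \<nu>) \<in> deflated_solutions K f N \<alpha> \<delta> \<longleftrightarrow> \<nu> \<in> extensional (mu_index \<alpha> \<delta>) \<and>
    (\<exists>b. moments \<nu> b \<and> (\<forall>k<N. \<forall>l<\<delta>. nf b (taylor \<xi> (f k)) l = 0))"
proof -
  define S where "S = {param_normal_form \<alpha> \<delta> (f k) $ i | k i. k < N \<and> i < \<delta>} \<union>
      {(mult_mat \<alpha> \<delta> i * mult_mat \<alpha> \<delta> j - mult_mat \<alpha> \<delta> j * mult_mat \<alpha> \<delta> i) $$ (k, l) | i j k l.
         k < \<delta> \<and> l < \<delta>}"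
  let ?ev = "mpoly_eval (case_dvar \<xi> \<nu>)" and ?R = "deflated_ring K \<alpha> \<delta>"
  have K': "subring_set K" by (rule subring_set_subfield[OF K])
  have zeros: "(\<forall>p\<in>deflated_ideal K f N \<alpha> \<delta>. ?ev p = 0) \<longleftrightarrow> (\<forall>p\<in>S. ?ev p = 0)"
  proof
    assume S: "\<forall>p\<in>S. ?ev p = 0"
    have "ideal {p \<in> carrier ?R. ?ev p = 0} ?R"
      unfolding deflated_ring_def using subring_setD[OF subring_set_mpoly_ring[OF K']]
      by (intro ideal_mpoly_ringI[OF K']) auto
    moreover have "S \<subseteq> carrier ?R"
      unfolding S_def by (rule generators_in_deflated_ring[OF K f])
    ultimately have "deflated_ideal K f N \<alpha> \<delta> \<subseteq> {p \<in> carrier ?R. ?ev p = 0}"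
      unfolding deflated_ideal_def S_def[symmetric] using S by (intro genideal_leI) auto
    then show "\<forall>p\<in>deflated_ideal K f N \<alpha> \<delta>. ?ev p = 0" by blast
  qed (auto simp: deflated_ideal_def S_def[symmetric] intro: subsetD[OF subset_genideal])
  have "(\<forall>p\<in>S. ?ev p = 0) \<longleftrightarrow> commuting \<nu> \<and>
      (\<forall>k<N. \<forall>l<\<delta>. nf (ordered_moments \<nu>) (taylor \<xi> (f k)) l = 0)"
  proof -
    have "(\<forall>p\<in>S. ?ev p = 0) \<longleftrightarrow>
      (\<forall>k<N. \<forall>l<\<delta>. ?ev (param_normal_form \<alpha> \<delta> (f k) $ l) = 0) \<and>
      (\<forall>i j. \<forall>k<\<delta>. \<forall>l<\<delta>. ?ev ((mult_mat \<alpha> \<delta> i * mult_mat \<alpha> \<delta> j - mult_mat \<alpha> \<delta> j * mult_mat \<alpha> \<delta> i) $$ (k, l)) = 0)"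
      unfolding S_def by blast
    then show ?thesis
      by (auto simp: eval_param_normal_form eval_commutator commuting_def simp del: index_minus_mat index_mult_mat)
  qed
  also have "\<dots> \<longleftrightarrow> (\<exists>b. moments \<nu> b \<and> (\<forall>k<N. \<forall>l<\<delta>. nf b (taylor \<xi> (f k)) l = 0))"
  proof -
    have "nf b p l = nf (ordered_moments \<nu>) p l" if "moments \<nu> b" "l < \<delta>" for b p l
      using moments_eq_ordered_moments[OF that] by (simp add: nf_def)
    then show ?thesis using moments_ordered_moments moments_commuting by (metis (no_types, lifting))
  qed
  finally show ?thesis by (simp add: deflated_solutions_def zeros)
qed

end

section \<open>The basis pair of a family of moments\<close>

lemma lookup_dfun_scale [simp]: "lookup (dfun_scale c L) g = c * lookup L g"
  by (simp add: dfun_scale_def Poly_Mapping.map.rep_eq when_def)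

lemma vector_space_dfun: "vector_space dfun_scale"
  by unfold_locales (auto intro!: poly_mapping_eqI simp: lookup_add algebra_simps)

lemma nu_coeff_simps [simp]:
  "nu_coeff 0 g = 0" "nu_coeff (L + M) g = nu_coeff L g + nu_coeff M g"
  "nu_coeff (dfun_scale c L) g = c * nu_coeff L g"
  by (simp_all add: nu_coeff_def lookup_add algebra_simps)

lemma nu_coeff_sum [simp]: "nu_coeff (sum f A) g = (\<Sum>a\<in>A. nu_coeff (f a) g)"
  by (induction A rule: infinite_finite_induct) simp_all

lemma dfun_eqI: "(\<And>g. nu_coeff L g = nu_coeff M g) \<Longrightarrow> L = M"
  by (rule poly_mapping_eqI) (simp add: nu_coeff_def)

lemma in_keys_nu_coeff: "g \<in> keys L \<longleftrightarrow> nu_coeff L g \<noteq> 0"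
  by (simp add: nu_coeff_def in_keys_iff)

lemma dfun_ord_le_iff: "dfun_ord L \<le> t \<longleftrightarrow> (\<forall>g. nu_coeff L g \<noteq> 0 \<longrightarrow> expo_deg g \<le> t)"
  by (auto simp: dfun_ord_def in_keys_nu_coeff)

lemma dfun_apply_dfun_linear [simp]:
  "dfun_apply \<xi> (L + M) p = dfun_apply \<xi> L p + dfun_apply \<xi> M p"
  "dfun_apply \<xi> (dfun_scale c L) p = c * dfun_apply \<xi> L p"
  by (simp_all add: dfun_apply_lincomb lincomb_def algebra_simps sum.distrib sum_distrib_left)

lemma dfun_apply_zero_dfun [simp]: "dfun_apply \<xi> 0 p = 0"
  by (simp add: dfun_apply_def)

lemma subspace_dual_space: "module.subspace dfun_scale (dual_space \<xi> Q)"
proof -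
  interpret vector_space dfun_scale by (rule vector_space_dfun)
  show ?thesis by (intro subspaceI) (auto simp: dual_space_def)
qed

lemma subspace_dfun_ord_le: "module.subspace dfun_scale {L. dfun_ord L \<le> t}"
proof -
  interpret vector_space dfun_scale by (rule vector_space_dfun)
  show ?thesis
    by (intro subspaceI) (auto simp: dfun_ord_le_iff, metis add.right_neutral)
qed

context lower_exponents
begin

lemma nf_linear [simp]:
  "nf b 0 l = 0" "nf b (p + q) l = nf b p l + nf b q l" "nf b (Const c * p) l = c * nf b p l"
  "nf b (Poly_Mapping.single g c) l = c * b g l"
  by (simp_all add: nf_def lincomb_add lincomb_Const_mult)

lemma nf_sum [simp]: "nf b (sum f A) l = (\<Sum>a\<in>A. nf b (f a) l)"
  by (induction A rule: infinite_finite_induct) simp_all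

lemma nf_diff [simp]: "nf b (p - q) l = nf b p l - nf b q l"
  using nf_linear(2)[of b "p - q" q l] by simp

text \<open>The action of \<open>p\<close> on the vector \<open>nf b q\<close>: the combination of the moments at \<open>\<alpha> k + m\<close> over the monomials \<open>m\<close>
  of \<open>p\<close> is \<open>p\<close> applied to \<open>e\<^sub>k\<close>. In particular the kernel of the normal form is an ideal.\<close>

lemma nf_mult:
  assumes "moments \<nu> b" "l < \<delta>"
  shows "nf b (p * q) l = (\<Sum>k<\<delta>. nf b q k * lincomb id (\<lambda>m. b (\<alpha> k + m) l) p)"
proof -
  have inner: "lincomb id (\<lambda>n. b (m + n) l) q = (\<Sum>k<\<delta>. b (\<alpha> k + m) l * nf b q k)" for m
  proof -
    have "(\<lambda>n. b (m + n) l) = (\<lambda>n. \<Sum>k<\<delta>. b (\<alpha> k + m) l * b n k)"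
    proof
      fix n
      have "b (m + n) l = (\<Sum>k<\<delta>. b n k * b (\<alpha> k + m) l)"
        by (subst add.commute) (rule moments_add[OF assms])
      also have "\<dots> = (\<Sum>k<\<delta>. b (\<alpha> k + m) l * b n k)"
        by (intro sum.cong mult.commute) simp
      finally show "b (m + n) l = (\<Sum>k<\<delta>. b (\<alpha> k + m) l * b n k)" .
    qed
    then have "lincomb id (\<lambda>n. b (m + n) l) q = lincomb id (\<lambda>n. \<Sum>k<\<delta>. b (\<alpha> k + m) l * b n k) q"
      by (rule arg_cong)
    then show ?thesis
      unfolding nf_def lincomb_coeff_sum lincomb_coeff_scale .
  qed
  have "nf b (p * q) l = lincomb id (\<lambda>m. lincomb id (\<lambda>n. b (m + n) l) q) p"
    by (simp add: nf_def lincomb_mult)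
  also have "\<dots> = (\<Sum>k<\<delta>. lincomb id (\<lambda>m. b (\<alpha> k + m) l) p * nf b q k)"
    unfolding inner by (simp only: lincomb_coeff_sum lincomb_coeff_scale_right)
  finally show ?thesis by (simp add: mult.commute)
qed

lemma moments_row_0:
  assumes "moments \<nu> b"
  shows "b g 0 = (if g = 0 then 1 else 0)"
proof (cases "g = 0")
  case True
  then show ?thesis using moments_0[OF assms pos] by simp
next
  case False
  then have "expo_deg (\<alpha> 0) < expo_deg g" by (simp add: alpha_0 flip: neq0_conv)
  then show ?thesis using moments_deg[OF assms pos] False by simp
qed

lemma nf_row_0:
  assumes "moments \<nu> b"
  shows "nf b p 0 = lookup p 0"
  unfolding nf_def moments_row_0[OF assms] by (subst lincomb_superset[where A = "{0}"]) auto

definition kernel :: "('n \<Rightarrow> complex) \<Rightarrow> ('n expo \<Rightarrow> nat \<Rightarrow> complex) \<Rightarrow> 'n mpoly set" where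
  "kernel \<xi> b = {p. \<forall>l<\<delta>. nf b (taylor \<xi> p) l = 0}"

lemma ideal_kernel:
  assumes "moments \<nu> b"
  shows "ideal (kernel \<xi> b) Cx"
  by (rule ideal_mpoly_ringI) (auto simp: kernel_def nf_mult[OF assms])

text \<open>The normal form of a shifted basis monomial is a unit vector, so \<open>p\<close> and the basis combination
  with the coefficients \<open>nf b p\<close> have the same normal form.\<close>

lemma residue_in_kernel:
  assumes "moments \<nu> b"
  shows "p - (\<Sum>k<\<delta>. Const (nf b (taylor \<xi> p) k) * shifted_monomial \<xi> (\<alpha> k)) \<in> kernel \<xi> b"
  by (simp add: kernel_def moments_basis[OF assms])

text \<open>The functional \<open>(x - \<xi>)\<^sup>g \<mapsto> b g l\<close>. The sum may be cut off at the degree of \<open>\<alpha> l\<close> because the other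
  moments vanish.\<close>

definition dual_fun :: "('n expo \<Rightarrow> nat \<Rightarrow> complex) \<Rightarrow> nat \<Rightarrow> 'n dfun" where
  "dual_fun b l = (\<Sum>g | expo_deg g \<le> expo_deg (\<alpha> l). Poly_Mapping.single g (b g l / expo_fact g))"

lemma nu_coeff_single: "nu_coeff (Poly_Mapping.single h c) g = (if g = h then expo_fact g * c else 0)"
  by (simp add: nu_coeff_def lookup_single when_def)

lemma nu_coeff_1: "nu_coeff 1 g = (if g = 0 then 1 else 0)"
  by (simp add: nu_coeff_def lookup_one when_def expo_fact_def)

lemma nu_coeff_dual_fun:
  assumes "moments \<nu> b" "l < \<delta>"
  shows "nu_coeff (dual_fun b l) g = b g l"
  using moments_deg[OF assms, of g]
  by (cases "expo_deg g \<le> expo_deg (\<alpha> l)")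
    (auto simp: dual_fun_def nu_coeff_single finite_expo_deg_le)

lemma dfun_apply_dual_fun:
  assumes "moments \<nu> b" "l < \<delta>"
  shows "dfun_apply \<xi> (dual_fun b l) p = nf b (taylor \<xi> p) l"
  by (simp add: dfun_apply_lincomb nf_def nu_coeff_dual_fun[OF assms, abs_def])

lemma dual_fun_in_dual_space:
  "moments \<nu> b \<Longrightarrow> l < \<delta> \<Longrightarrow> dual_fun b l \<in> dual_space \<xi> (kernel \<xi> b)"
  by (simp add: dual_space_def kernel_def dfun_apply_dual_fun)

lemma dfun_ord_dual_fun:
  assumes "moments \<nu> b" "l < \<delta>"
  shows "dfun_ord (dual_fun b l) = expo_deg (\<alpha> l)"
proof (rule order.antisym)
  show "dfun_ord (dual_fun b l) \<le> expo_deg (\<alpha> l)"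
    using moments_deg[OF assms] by (force simp: dfun_ord_le_iff nu_coeff_dual_fun[OF assms])
  have "nu_coeff (dual_fun b l) (\<alpha> l) \<noteq> 0"
    by (simp add: nu_coeff_dual_fun[OF assms] moments_basis[OF assms(1,2,2)])
  then show "expo_deg (\<alpha> l) \<le> dfun_ord (dual_fun b l)"
    using dfun_ord_le_iff[of "dual_fun b l" "dfun_ord (dual_fun b l)"] by simp
qed

text \<open>A functional that vanishes on the kernel is determined by its values on the basis monomials.\<close>

lemma dual_space_expansion:
  assumes b: "moments \<nu> b" and L: "L \<in> dual_space \<xi> (kernel \<xi> b)"
  shows "L = (\<Sum>k<\<delta>. dfun_scale (nu_coeff L (\<alpha> k)) (dual_fun b k))"
proof (rule dfun_eqI)
  fix g
  have "shifted_monomial \<xi> g - (\<Sum>k<\<delta>. Const (b g k) * shifted_monomial \<xi> (\<alpha> k)) \<in> kernel \<xi> b"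
    using residue_in_kernel[OF b, of "shifted_monomial \<xi> g" \<xi>] by simp
  then have "dfun_apply \<xi> L (shifted_monomial \<xi> g - (\<Sum>k<\<delta>. Const (b g k) * shifted_monomial \<xi> (\<alpha> k))) = 0"
    using L unfolding dual_space_def by blast
  then have "nu_coeff L g = (\<Sum>k<\<delta>. nu_coeff L (\<alpha> k) * b g k)"
    by (simp add: mult.commute)
  then show "nu_coeff L g = nu_coeff (\<Sum>k<\<delta>. dfun_scale (nu_coeff L (\<alpha> k)) (dual_fun b k)) g"
    by (simp add: nu_coeff_dual_fun[OF b])
qed

lemma basis_of_quotient_kernel:
  assumes b: "moments \<nu> b"
  shows "basis_of_quotient (kernel \<xi> b) (\<lambda>i. shifted_monomial \<xi> (\<alpha> i)) \<delta>"
  unfolding basis_of_quotient_def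
  using residue_in_kernel[OF b] by (auto simp: kernel_def moments_basis[OF b])

lemma basis_of_dual_kernel:
  assumes b: "moments \<nu> b"
  shows "basis_of_dual (dual_space \<xi> (kernel \<xi> b)) (dual_fun b) \<delta>"
proof -
  interpret vector_space dfun_scale by (rule vector_space_dfun)
  let ?S = "dual_fun b ` {..<\<delta>}"
  have coeff: "nu_coeff (dual_fun b i) (\<alpha> j) = (if i = j then 1 else 0)" if "i < \<delta>" "j < \<delta>" for i j
    using that by (simp add: nu_coeff_dual_fun[OF b] moments_basis[OF b])
  have inj: "inj_on (dual_fun b) {..<\<delta>}"
    using coeff by (intro inj_onI) (metis lessThan_iff zero_neq_one)
  moreover have "independent ?S"
  proof
    assume "dependent ?S"
    then obtain u i where i: "i < \<delta>" "u (dual_fun b i) \<noteq> 0" and "(\<Sum>v\<in>?S. dfun_scale (u v) v) = 0"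
      by (subst (asm) dependent_finite) auto
    then have "nu_coeff (\<Sum>k<\<delta>. dfun_scale (u (dual_fun b k)) (dual_fun b k)) (\<alpha> i) = 0"
      by (simp add: sum.reindex[OF inj] o_def del: nu_coeff_sum)
    then show False using i coeff by simp
  qed
  moreover have "span ?S = dual_space \<xi> (kernel \<xi> b)"
  proof
    show "span ?S \<subseteq> dual_space \<xi> (kernel \<xi> b)"
      using dual_fun_in_dual_space[OF b] by (intro span_minimal subspace_dual_space) auto
    show "dual_space \<xi> (kernel \<xi> b) \<subseteq> span ?S"
    proof
      fix L assume "L \<in> dual_space \<xi> (kernel \<xi> b)"
      from dual_space_expansion[OF b this] show "L \<in> span ?S"
        by (metis (no_types, lifting) imageI span_base span_scale span_sum)
    qed
  qed
  ultimately show ?thesis by (simp add: basis_of_dual_def)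
qed

lemma dual_fun_form:
  assumes b: "moments \<nu> b" and i: "i < \<delta>"
  shows "dual_fun b i = Poly_Mapping.single (\<alpha> i) (1 / expo_fact (\<alpha> i)) +
    (\<Sum>g | expo_deg g \<le> expo_deg (\<alpha> i) \<and> g \<notin> exponents \<alpha> \<delta>. Poly_Mapping.single g (b g i / expo_fact g))"
proof (rule dfun_eqI)
  fix g
  let ?A = "{g. expo_deg g \<le> expo_deg (\<alpha> i) \<and> g \<notin> exponents \<alpha> \<delta>}"
  have fin: "finite ?A" by (rule finite_subset[OF _ finite_expo_deg_le]) auto
  have "b g i = (if g = \<alpha> i then 1 else 0) + (if g \<in> ?A then b g i else 0)"
  proof (cases "g \<in> exponents \<alpha> \<delta>")
    case True
    then obtain k where "k < \<delta>" "g = \<alpha> k" by auto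
    then show ?thesis using i moments_basis[OF b] alpha_eq_iff[of k i] by auto
  next
    case False
    then show ?thesis using i moments_deg[OF b i, of g] by auto
  qed
  moreover have "nu_coeff (\<Sum>g\<in>?A. Poly_Mapping.single g (b g i / expo_fact g)) g = (if g \<in> ?A then b g i else 0)"
    using fin by (simp add: nu_coeff_single)
  moreover have "nu_coeff (Poly_Mapping.single (\<alpha> i) (1 / expo_fact (\<alpha> i))) g = (if g = \<alpha> i then 1 else 0)"
    by (simp add: nu_coeff_single)
  ultimately show "nu_coeff (dual_fun b i) g = nu_coeff (Poly_Mapping.single (\<alpha> i) (1 / expo_fact (\<alpha> i)) +
    (\<Sum>g\<in>?A. Poly_Mapping.single g (b g i / expo_fact g))) g"
    by (simp only: nu_coeff_dual_fun[OF b i] nu_coeff_simps)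
qed

lemma connected: "connected_to_one \<alpha> \<delta>"
  unfolding connected_to_one_def
proof (intro allI impI)
  fix k assume k: "k < \<delta>" "\<alpha> k \<noteq> 0"
  then obtain i where "lookup (\<alpha> k) i \<noteq> 0" by (auto simp: poly_mapping_eq_iff fun_eq_iff)
  then have e: "\<alpha> k - unit_expo i + unit_expo i = \<alpha> k"
    using minus_unit_expo_add[of "\<alpha> k" i "unit_expo i"] by simp
  then have "\<alpha> k - unit_expo i + unit_expo i \<in> exponents \<alpha> \<delta>" using k by simp
  then obtain j where "j < \<delta>" "\<alpha> k - unit_expo i = \<alpha> j" by (rule exponents_predecessor)
  then show "\<exists>j<\<delta>. \<exists>i. \<alpha> k = \<alpha> j + unit_expo i" using e by metis
qed

theorem primal_dual_basis_pair_kernel: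
  assumes b: "moments \<nu> b"
  shows "primal_dual_basis_pair \<xi> \<alpha> \<delta> (kernel \<xi> b) (dual_fun b)"
proof -
  interpret vector_space dfun_scale by (rule vector_space_dfun)
  have "dual_fun b 0 = Poly_Mapping.single 0 1"
  proof (rule dfun_eqI)
    fix g show "nu_coeff (dual_fun b 0) g = nu_coeff (Poly_Mapping.single 0 1) g"
      by (simp add: nu_coeff_dual_fun[OF b pos] nu_coeff_1 moments_row_0[OF b])
  qed
  moreover have "{M \<in> dual_space \<xi> (kernel \<xi> b). dfun_ord M \<le> t} =
      span {dual_fun b j | j. j < \<delta> \<and> dfun_ord (dual_fun b j) \<le> t}" for t
  proof
    have "subspace (dual_space \<xi> (kernel \<xi> b) \<inter> {M. dfun_ord M \<le> t})"
      by (intro subspace_inter subspace_dual_space subspace_dfun_ord_le)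
    then show "span {dual_fun b j | j. j < \<delta> \<and> dfun_ord (dual_fun b j) \<le> t} \<subseteq>
        {M \<in> dual_space \<xi> (kernel \<xi> b). dfun_ord M \<le> t}"
      using dual_fun_in_dual_space[OF b]
      by (intro span_minimal) (auto simp: Int_def)
    show "{M \<in> dual_space \<xi> (kernel \<xi> b). dfun_ord M \<le> t} \<subseteq>
        span {dual_fun b j | j. j < \<delta> \<and> dfun_ord (dual_fun b j) \<le> t}"
    proof safe
      fix M assume M: "M \<in> dual_space \<xi> (kernel \<xi> b)" "dfun_ord M \<le> t"
      have "dfun_scale (nu_coeff M (\<alpha> k)) (dual_fun b k) \<in>
          span {dual_fun b j | j. j < \<delta> \<and> dfun_ord (dual_fun b j) \<le> t}" if "k < \<delta>" for k
      proof (cases "nu_coeff M (\<alpha> k) = 0")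
        case False
        then have "dfun_ord (dual_fun b k) \<le> t"
          using M(2) that by (simp add: dfun_ord_le_iff[of M] dfun_ord_dual_fun[OF b])
        then show ?thesis using that by (intro span_scale span_base) auto
      qed (simp add: span_zero)
      then have "(\<Sum>k<\<delta>. dfun_scale (nu_coeff M (\<alpha> k)) (dual_fun b k)) \<in>
          span {dual_fun b j | j. j < \<delta> \<and> dfun_ord (dual_fun b j) \<le> t}"
        by (intro span_sum) simp
      then show "M \<in> span {dual_fun b j | j. j < \<delta> \<and> dfun_ord (dual_fun b j) \<le> t}"
        using dual_space_expansion[OF b M(1)] by simp
    qed
  qed
  moreover have "dfun_ord (dual_fun b i) \<le> dfun_ord (dual_fun b j)" if "i \<le> j" "j < \<delta>" for i j
    using that deg_mono[of i j] by (simp add: dfun_ord_dual_fun[OF b])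
  moreover have "dfun_apply \<xi> (dual_fun b i) (shifted_monomial \<xi> (\<alpha> j)) = (if i = j then 1 else 0)"
    if "i < \<delta>" "j < \<delta>" for i j
    using that by (simp add: nu_coeff_dual_fun[OF b] moments_basis[OF b])
  moreover have "\<exists>c. dual_fun b i = Poly_Mapping.single (\<alpha> i) (1 / expo_fact (\<alpha> i)) +
        (\<Sum>g | expo_deg g \<le> expo_deg (\<alpha> i) \<and> g \<notin> exponents \<alpha> \<delta>.
           Poly_Mapping.single g (c g / expo_fact g))" if "i < \<delta>" for i
    using dual_fun_form[OF b that] by (intro exI[of _ "\<lambda>g. b g i"])
  ultimately show ?thesis
    unfolding primal_dual_basis_pair_def
    using basis_of_quotient_kernel[OF b] basis_of_dual_kernel[OF b] connected alpha_0
      dfun_ord_dual_fun[OF b pos]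
    by (intro conjI allI impI) (simp_all del: dfun_apply_shifted_monomial)
qed

text \<open>In the quotient by \<open>Q\<close> the class of \<open>(x - \<xi>)\<^sup>g\<close> has the coordinates \<open>L\<^sub>k((x - \<xi>)\<^sup>g)\<close>. Multiplying by
  \<open>x\<^sub>i - \<xi>\<^sub>i\<close> gives the recursion, with matrix entries \<open>L\<^sub>l((x - \<xi>)\<^sup>h)\<close>, where \<open>h = \<alpha> k + e\<^sub>i\<close>. These are the entries
  of \<open>M\<^sub>i(\<nu>)\<close>: by duality if \<open>h\<close> is in \<open>E\<close>, by the assumption on \<open>\<nu>\<close> if \<open>|h| \<le> |\<alpha> l|\<close>, and because \<open>L\<^sub>l\<close> has no
  terms of degree above \<open>|\<alpha> l|\<close> otherwise.\<close>

theorem primal_dual_basis_pair_moments: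
  assumes Q: "ideal Q Cx" and pair: "primal_dual_basis_pair \<xi> \<alpha> \<delta> Q L"
    and nu: "\<And>i g. i < \<delta> \<Longrightarrow> (\<alpha> i, g) \<in> mu_index \<alpha> \<delta> \<Longrightarrow> nu_coeff (L i) g = \<nu> (\<alpha> i, g)"
  shows "moments \<nu> (\<lambda>g l. nu_coeff (L l) g)"
proof -
  interpret vector_space dfun_scale by (rule vector_space_dfun)
  have form: "\<forall>i<\<delta>. \<exists>c. L i = Poly_Mapping.single (\<alpha> i) (1 / expo_fact (\<alpha> i)) +
        (\<Sum>b | expo_deg b \<le> expo_deg (\<alpha> i) \<and> b \<notin> exponents \<alpha> \<delta>.
           Poly_Mapping.single b (c b / expo_fact b))"
    using pair unfolding primal_dual_basis_pair_def by (elim conjE)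
  have orth: "nu_coeff (L i) (\<alpha> j) = (if i = j then 1 else 0)" if "i < \<delta>" "j < \<delta>" for i j
    using pair that by (simp add: primal_dual_basis_pair_def)
  have vanish: "dfun_apply \<xi> (L i) p = 0" if "i < \<delta>" "p \<in> Q" for i p
  proof -
    have "L i \<in> span (L ` {..<\<delta>})" using that by (intro span_base) auto
    then show ?thesis
      using pair that by (auto simp: primal_dual_basis_pair_def basis_of_dual_def dual_space_def)
  qed
  have mat_entry: "nu_coeff (L l) (\<alpha> k + unit_expo i) = mat_entry \<nu> i l k" if "l < \<delta>" "k < \<delta>" for i l k
  proof (cases "\<alpha> k + unit_expo i \<in> exponents \<alpha> \<delta>")
    case True
    then obtain m where m: "m < \<delta>" "\<alpha> k + unit_expo i = \<alpha> m" by auto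
    then have "mat_entry \<nu> i l k = (if l = m then 1 else 0)"
      using alpha_eq_iff[OF that(1) m(1)] by (simp add: mat_entry_def)
    then show ?thesis using orth[OF that(1) m(1)] m(2) by simp
  next
    case False
    then have ne: "\<alpha> l \<noteq> \<alpha> k + unit_expo i" using that by (metis imageI lessThan_iff)
    show ?thesis
    proof (cases "expo_deg (\<alpha> l) \<ge> expo_deg (\<alpha> k) + 1")
      case True
      then have "(\<alpha> l, \<alpha> k + unit_expo i) \<in> mu_index \<alpha> \<delta>"
        using that False unfolding mu_index_def by blast
      then show ?thesis using nu that ne False True by (simp add: mat_entry_def)
    next
      case small: False
      obtain c where c: "L l = Poly_Mapping.single (\<alpha> l) (1 / expo_fact (\<alpha> l)) +
        (\<Sum>b | expo_deg b \<le> expo_deg (\<alpha> l) \<and> b \<notin> exponents \<alpha> \<delta>.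
           Poly_Mapping.single b (c b / expo_fact b))"
        using form \<open>l < \<delta>\<close> by blast
      have "finite {b. expo_deg b \<le> expo_deg (\<alpha> l) \<and> b \<notin> exponents \<alpha> \<delta>}"
        by (rule finite_subset[OF _ finite_expo_deg_le]) auto
      then have "nu_coeff (L l) (\<alpha> k + unit_expo i) = 0"
        unfolding c using small ne by (simp add: nu_coeff_single eq_commute)
      then show ?thesis using small ne by (simp add: mat_entry_def)
    qed
  qed
  have "nu_coeff (L l) (g + unit_expo i) = (\<Sum>k<\<delta>. mat_entry \<nu> i l k * nu_coeff (L k) g)" if "l < \<delta>" for g i l
  proof -
    obtain c where c: "shifted_monomial \<xi> g - (\<Sum>k<\<delta>. Const (c k) * shifted_monomial \<xi> (\<alpha> k)) \<in> Q" (is "?r \<in> Q")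
      using pair unfolding primal_dual_basis_pair_def basis_of_quotient_def by blast
    have ck: "nu_coeff (L k) g = c k" if "k < \<delta>" for k
      using vanish[OF that c] that orth[OF that] by (simp add: eq_commute[of k])
    have "shifted_monomial \<xi> (unit_expo i) * ?r \<in> Q"
      using ideal_mpoly_ringD(3)[OF Q c] by simp
    moreover have "shifted_monomial \<xi> (unit_expo i) * ?r = shifted_monomial \<xi> (g + unit_expo i) -
        (\<Sum>k<\<delta>. Const (c k) * shifted_monomial \<xi> (\<alpha> k + unit_expo i))"
      by (simp add: right_diff_distrib sum_distrib_left mult_ac)
    ultimately have "dfun_apply \<xi> (L l) (shifted_monomial \<xi> (g + unit_expo i) -
        (\<Sum>k<\<delta>. Const (c k) * shifted_monomial \<xi> (\<alpha> k + unit_expo i))) = 0"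
      by (intro vanish[OF \<open>l < \<delta>\<close>]) (simp only:)
    then have "nu_coeff (L l) (g + unit_expo i) = (\<Sum>k<\<delta>. c k * nu_coeff (L l) (\<alpha> k + unit_expo i))"
      by (simp del: shifted_monomial_simps)
    also have "\<dots> = (\<Sum>k<\<delta>. mat_entry \<nu> i l k * nu_coeff (L k) g)"
      using that by (intro sum.cong) (simp_all add: mat_entry ck)
    finally show ?thesis .
  qed
  moreover have "nu_coeff (L l) 0 = (if l = 0 then 1 else 0)" if "l < \<delta>" for l
    using orth[OF that pos] alpha_0 by simp
  ultimately show ?thesis by (simp add: moments_def)
qed

end

section \<open>Isolated solutions\<close>

definition linear_functional :: "('v mpoly \<Rightarrow> complex) \<Rightarrow> bool" where
  "linear_functional L \<longleftrightarrow> (\<forall>p q. L (p + q) = L p + L q) \<and> (\<forall>c p. L (Const c * p) = c * L p)"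

lemma linear_functionalD:
  assumes "linear_functional L"
  shows "L (p + q) = L p + L q" "L (Const c * p) = c * L p" "L 0 = 0" "L (p - q) = L p - L q"
    "L (\<Sum>a\<in>A. h a) = (\<Sum>a\<in>A. L (h a))"
proof -
  show add: "L (p + q) = L p + L q" for p q using assms by (simp add: linear_functional_def)
  show "L (Const c * p) = c * L p" using assms by (simp add: linear_functional_def)
  show zero: "L 0 = 0" using add[of 0 0] by simp
  show "L (p - q) = L p - L q" using add[of "p - q" q] by simp
  show "L (\<Sum>a\<in>A. h a) = (\<Sum>a\<in>A. L (h a))"
    by (induction A rule: infinite_finite_induct) (simp_all add: zero add)
qed

lemma separating_functional:
  assumes Q: "ideal Q Cx" and p0: "p0 \<notin> Q"
  obtains L where "linear_functional L" "\<And>p. p \<in> Q \<Longrightarrow> L p = 0" "L p0 \<noteq> 0"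
proof -
  have 1: "vector_space (\<lambda>c (p :: 'a mpoly). Const c * p)"
    by (rule vector_space.intro) (simp_all only: distrib_left distrib_right Const_add Const_mult mult.assoc Const_simps mult_1)
  have 2: "vector_space ((*) :: complex \<Rightarrow> complex \<Rightarrow> complex)"
    by (rule vector_space.intro) (simp_all only: distrib_left distrib_right mult.assoc mult_1)
  interpret vector_space_pair "\<lambda>c (p :: 'a mpoly). Const c * p" "(*) :: complex \<Rightarrow> complex \<Rightarrow> complex"
    by (rule vector_space_pair.intro[OF 1 2])
  have sub: "vs1.subspace Q"
    using ideal_mpoly_ringD[OF Q] by (intro vs1.subspaceI) auto
  obtain B where B: "B \<subseteq> Q" "vs1.independent B" "Q \<subseteq> vs1.span B"
    by (rule vs1.basis_exists[of Q])
  have "vs1.span B \<subseteq> Q" by (rule vs1.span_minimal[OF B(1) sub])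
  then have indep: "vs1.independent (insert p0 B)"
    using p0 by (intro vs1.independent_insertI B(2)) auto
  from linear_independent_extend[OF this, of "\<lambda>x. if x = p0 then 1 else 0"]
  obtain L where L: "Vector_Spaces.linear (\<lambda>c (p :: 'a mpoly). Const c * p) (*) L \<and>
    (\<forall>x\<in>insert p0 B. L x = (if x = p0 then 1 else 0))"
    by (rule exE)
  interpret L: Vector_Spaces.linear "\<lambda>c (p :: 'a mpoly). Const c * p" "(*)" L using L by (rule conjunct1)
  have "linear_functional L" unfolding linear_functional_def by (intro conjI allI L.add L.scale)
  moreover have "L p = 0" if "p \<in> Q" for p
  proof -
    have zero: "L x = 0" if "x \<in> B" for x using L that B(1) p0 by auto
    show ?thesis by (rule L.eq_0_on_span[OF zero subsetD[OF B(3) that]])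
  qed
  moreover have "L p0 \<noteq> 0" using L by simp
  ultimately show ?thesis by (rule that)
qed

context lower_exponents
begin

lemma last_index: "\<delta> - 1 < \<delta>" using pos by simp

text \<open>Take any functional that separates a point of the kernel from \<open>Q\<close>. Multiply it by a shifted
  monomial \<open>(x - \<xi>)\<^sup>\<gamma>\<close> of the largest degree such that the product is still non-zero on the kernel. Then a
  further factor \<open>x\<^sub>i - \<xi>\<^sub>i\<close> makes it vanish on the kernel. Such a degree exists because \<open>Q\<close> contains the
  shifted monomials of high degree. Composing with the projection to the kernel along the basis monomials makes
  it vanish on these too and changes nothing on the kernel.\<close>

lemma socle_functional:
  assumes b: "moments \<nu> b" and Q: "ideal Q Cx" and sub: "Q \<subseteq> kernel \<xi> b"
    and high: "\<And>g. d < expo_deg g \<Longrightarrow> shifted_monomial \<xi> g \<in> Q"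
    and p0: "p0 \<in> kernel \<xi> b" "p0 \<notin> Q"
  obtains L p1 where "linear_functional L" "\<And>p. p \<in> Q \<Longrightarrow> L p = 0"
    "\<And>k. k < \<delta> \<Longrightarrow> L (shifted_monomial \<xi> (\<alpha> k)) = 0"
    "\<And>i p. p \<in> kernel \<xi> b \<Longrightarrow> L (shifted_monomial \<xi> (unit_expo i) * p) = 0"
    "L p1 \<noteq> 0"
proof -
  obtain L where L: "linear_functional L" "\<And>p. p \<in> Q \<Longrightarrow> L p = 0" "L p0 \<noteq> 0"
    using separating_functional[OF Q p0(2)] by blast
  note lin = linear_functionalD[OF L(1)]
  let ?act = "\<lambda>g. \<exists>p\<in>kernel \<xi> b. L (shifted_monomial \<xi> g * p) \<noteq> 0"
  have 0: "?act 0" using p0(1) L(3) by auto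
  have bound: "expo_deg g < d + 1" if act: "?act g" for g
  proof (rule ccontr)
    assume "\<not> expo_deg g < d + 1"
    then have "p * shifted_monomial \<xi> g \<in> Q" for p
      using ideal_mpoly_ringD(3)[OF Q high] by simp
    then show False using act L(2) by (metis mult.commute)
  qed
  obtain \<gamma> where \<gamma>: "?act \<gamma>" "\<And>g. ?act g \<Longrightarrow> expo_deg g \<le> expo_deg \<gamma>"
    using ex_has_greatest_nat[of ?act 0 expo_deg "d + 1", OF 0] bound by blast
  \<comment> \<open>\<open>R\<close> is the projection to the kernel along the span of the basis monomials.\<close>
  define R where "R p = p - (\<Sum>k<\<delta>. Const (nf b (taylor \<xi> p) k) * shifted_monomial \<xi> (\<alpha> k))" for p
  have R_add: "R (p + q) = R p + R q" for p q
    by (simp add: R_def Const_add algebra_simps sum.distrib)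
  have R_scale: "R (Const c * p) = Const c * R p" for c p
    by (simp add: R_def Const_mult algebra_simps sum_distrib_left)
  have R_kernel: "R p = p" if "p \<in> kernel \<xi> b" for p
    using that by (simp add: R_def kernel_def)
  have R_basis: "R (shifted_monomial \<xi> (\<alpha> k)) = 0" if "k < \<delta>" for k
  proof -
    have "(\<Sum>l<\<delta>. Const (b (\<alpha> k) l) * shifted_monomial \<xi> (\<alpha> l)) =
        (\<Sum>l<\<delta>. shifted_monomial \<xi> (\<alpha> l) * (if l = k then 1 else 0))"
      using that by (intro sum.cong) (auto simp: moments_basis[OF b])
    then show ?thesis using that by (simp add: R_def)
  qed
  define L' where "L' p = L (shifted_monomial \<xi> \<gamma> * R p)" for p
  obtain p1 where p1: "p1 \<in> kernel \<xi> b" "L (shifted_monomial \<xi> \<gamma> * p1) \<noteq> 0" using \<gamma>(1) by blast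
  show ?thesis
  proof (rule that)
    show "linear_functional L'"
      unfolding linear_functional_def L'_def
      by (simp add: R_add R_scale distrib_left lin mult.left_commute[of _ "Const _"])
    show "L' p = 0" if "p \<in> Q" for p
      using that sub R_kernel[of p] ideal_mpoly_ringD(3)[OF Q that] by (auto simp: L'_def intro!: L(2))
    show "L' (shifted_monomial \<xi> (\<alpha> k)) = 0" if "k < \<delta>" for k
      using R_basis[OF that] by (simp add: L'_def lin)
    show "L' (shifted_monomial \<xi> (unit_expo i) * p) = 0" if "p \<in> kernel \<xi> b" for i p
    proof -
      have "\<not> ?act (\<gamma> + unit_expo i)" using \<gamma>(2)[of "\<gamma> + unit_expo i"] by auto
      then have "L (shifted_monomial \<xi> (\<gamma> + unit_expo i) * p) = 0" using that by blast
      moreover have "shifted_monomial \<xi> (unit_expo i) * p \<in> kernel \<xi> b"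
        using ideal_mpoly_ringD(3)[OF ideal_kernel[OF b] that] by simp
      ultimately show ?thesis
        using R_kernel by (simp add: L'_def mult.assoc)
    qed
    show "L' p1 \<noteq> 0" using p1 R_kernel by (simp add: L'_def)
  qed
qed

text \<open>The parameters after \<open>t \<Lambda>\<close> has been added to the last functional, where \<open>\<Lambda>\<close> has the value \<open>w g\<close>
  at \<open>(x - \<xi>)\<^sup>g\<close>.\<close>

definition perturb_nu :: "('n expo \<Rightarrow> complex) \<Rightarrow> ('n expo \<times> 'n expo \<Rightarrow> complex) \<Rightarrow> complex \<Rightarrow>
    ('n expo \<times> 'n expo \<Rightarrow> complex)" where
  "perturb_nu w \<nu> t = (\<lambda>p. \<nu> p + t * (if p \<in> mu_index \<alpha> \<delta> \<and> fst p = \<alpha> (\<delta> - 1) then w (snd p) else 0))"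

definition perturb_moments :: "('n expo \<Rightarrow> complex) \<Rightarrow> ('n expo \<Rightarrow> nat \<Rightarrow> complex) \<Rightarrow> complex \<Rightarrow>
    ('n expo \<Rightarrow> nat \<Rightarrow> complex)" where
  "perturb_moments w b t = (\<lambda>g l. b g l + (if l = \<delta> - 1 then t * w g else 0))"

text \<open>In \<open>M\<^sub>i\<close> only the last row changes, by the values \<open>t w(\<alpha> k + e\<^sub>i)\<close>. There is no term in \<open>t\<^sup>2\<close>: both the
  last column of \<open>M\<^sub>i\<close> and \<open>w(\<alpha> k + e\<^sub>i)\<close> for the last index \<open>k\<close> vanish, since the last index has the
  largest degree. The assumption \<open>w_step\<close> is that \<open>\<Lambda>\<close> vanishes on
  \<open>x\<^sub>i - \<xi>\<^sub>i\<close> times the kernel.\<close>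

lemma moments_perturb:
  assumes b: "moments \<nu> b"
    and w_basis: "\<And>k. k < \<delta> \<Longrightarrow> w (\<alpha> k) = 0"
    and w_high: "\<And>g. expo_deg (\<alpha> (\<delta> - 1)) < expo_deg g \<Longrightarrow> w g = 0"
    and w_step: "\<And>g i. w (g + unit_expo i) = (\<Sum>k<\<delta>. b g k * w (\<alpha> k + unit_expo i))"
  shows "moments (perturb_nu w \<nu> t) (perturb_moments w b t)"
proof -
  let ?m = "\<delta> - 1"
  have mat_entry: "mat_entry (perturb_nu w \<nu> t) i l k =
      mat_entry \<nu> i l k + (if l = ?m then t * w (\<alpha> k + unit_expo i) else 0)" if "l < \<delta>" "k < \<delta>" for i l k
  proof (cases "\<alpha> k + unit_expo i \<in> exponents \<alpha> \<delta>")
    case True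
    then have "w (\<alpha> k + unit_expo i) = 0" using w_basis by auto
    then show ?thesis using True by (simp add: mat_entry_def)
  next
    case False
    then have ne: "\<alpha> l \<noteq> \<alpha> k + unit_expo i" using that by (metis imageI lessThan_iff)
    show ?thesis
    proof (cases "expo_deg (\<alpha> l) \<ge> expo_deg (\<alpha> k) + 1")
      case True
      then have "(\<alpha> l, \<alpha> k + unit_expo i) \<in> mu_index \<alpha> \<delta>"
        using that False unfolding mu_index_def by blast
      then show ?thesis
        using False ne True alpha_eq_iff[OF that(1) last_index] by (simp add: mat_entry_def perturb_nu_def)
    next
      case small: False
      then have "w (\<alpha> k + unit_expo i) = 0" if "l = ?m" using that by (intro w_high) simp
      then show ?thesis using small ne by (auto simp: mat_entry_def)
    qed
  qed
  have last: "mat_entry \<nu> i l ?m = 0" "w (\<alpha> ?m + unit_expo i) = 0" if "l < \<delta>" for i l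
  proof -
    have "expo_deg (\<alpha> l) \<le> expo_deg (\<alpha> ?m)" using deg_mono[of l ?m] that last_index by simp
    then show "mat_entry \<nu> i l ?m = 0" using mat_entry_deg[of \<nu> i l ?m] by force
    show "w (\<alpha> ?m + unit_expo i) = 0" by (rule w_high) simp
  qed
  have "perturb_moments w b t (g + unit_expo i) l =
      (\<Sum>k<\<delta>. mat_entry (perturb_nu w \<nu> t) i l k * perturb_moments w b t g k)" if "l < \<delta>" for g i l
  proof -
    have "mat_entry (perturb_nu w \<nu> t) i l k * perturb_moments w b t g k =
        mat_entry \<nu> i l k * b g k + (if l = ?m then t * (b g k * w (\<alpha> k + unit_expo i)) else 0)"
      if "k < \<delta>" for k
    proof (cases "k = ?m")
      case True
      show ?thesis
        unfolding True mat_entry[OF \<open>l < \<delta>\<close> last_index] last[OF \<open>l < \<delta>\<close>] by simp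
    next
      case False
      then show ?thesis
        by (simp add: mat_entry[OF \<open>l < \<delta>\<close> that] perturb_moments_def distrib_left distrib_right mult_ac)
    qed
    then have "(\<Sum>k<\<delta>. mat_entry (perturb_nu w \<nu> t) i l k * perturb_moments w b t g k) =
        (\<Sum>k<\<delta>. mat_entry \<nu> i l k * b g k + (if l = ?m then t * (b g k * w (\<alpha> k + unit_expo i)) else 0))"
      by (intro sum.cong) auto
    also have "\<dots> = (\<Sum>k<\<delta>. mat_entry \<nu> i l k * b g k) +
        (if l = ?m then t * (\<Sum>k<\<delta>. b g k * w (\<alpha> k + unit_expo i)) else 0)"
      by (simp add: sum.distrib sum_distrib_left)
    also have "\<dots> = perturb_moments w b t (g + unit_expo i) l"
      by (simp add: perturb_moments_def moments_step[OF b \<open>l < \<delta>\<close>] w_step[of g i])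
    finally show ?thesis ..
  qed
  moreover have "perturb_moments w b t 0 l = (if l = 0 then 1 else 0)" if "l < \<delta>" for l
    using w_basis[OF pos] by (simp add: alpha_0 perturb_moments_def moments_0[OF b that])
  ultimately show ?thesis unfolding moments_def by blast
qed

lemma continuous_on_perturb_nu: "continuous_on UNIV (\<lambda>t. (\<xi> :: 'n \<Rightarrow> complex, perturb_nu w \<nu> t))"
  unfolding perturb_nu_def
  by (intro continuous_on_Pair continuous_on_const continuous_on_coordinatewise_then_product)
    (intro continuous_intros)

theorem isolated_imp_kernel_subset:
  assumes K: "subfield K complex_ring" and f: "f ` {..<N} \<subseteq> carrier (mpoly_ring K UNIV)"
    and iso: "(\<xi>, \<nu>) isolated_in deflated_solutions K f N \<alpha> \<delta>"
    and b: "moments \<nu> b"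
    and Q: "ideal Q Cx" and fQ: "\<And>k. k < N \<Longrightarrow> f k \<in> Q" and sub: "Q \<subseteq> kernel \<xi> b"
    and high: "\<And>g. expo_deg (\<alpha> (\<delta> - 1)) < expo_deg g \<Longrightarrow> shifted_monomial \<xi> g \<in> Q"
  shows "kernel \<xi> b \<subseteq> Q"
proof (rule ccontr)
  assume "\<not> kernel \<xi> b \<subseteq> Q"
  then obtain p0 where "p0 \<in> kernel \<xi> b" "p0 \<notin> Q" by blast
  from socle_functional[OF b Q sub high this]
  obtain L p1 where L: "linear_functional L" "\<And>p. p \<in> Q \<Longrightarrow> L p = 0"
    "\<And>k. k < \<delta> \<Longrightarrow> L (shifted_monomial \<xi> (\<alpha> k)) = 0"
    "\<And>i p. p \<in> kernel \<xi> b \<Longrightarrow> L (shifted_monomial \<xi> (unit_expo i) * p) = 0"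
    "L p1 \<noteq> 0"
    by blast
  note lin = linear_functionalD[OF L(1)]
  define w where "w g = L (shifted_monomial \<xi> g)" for g
  have L_w: "L p = lincomb id w (taylor \<xi> p)" for p
    by (subst taylor_expansion[of p \<xi>]) (simp add: lincomb_def lin w_def)
  have w_step: "w (g + unit_expo i) = (\<Sum>k<\<delta>. b g k * w (\<alpha> k + unit_expo i))" for g i
  proof -
    have "shifted_monomial \<xi> g - (\<Sum>k<\<delta>. Const (b g k) * shifted_monomial \<xi> (\<alpha> k)) \<in> kernel \<xi> b"
      using residue_in_kernel[OF b, of "shifted_monomial \<xi> g" \<xi>] by simp
    from L(4)[OF this, of i] have "L (shifted_monomial \<xi> (g + unit_expo i) -
        (\<Sum>k<\<delta>. Const (b g k) * shifted_monomial \<xi> (\<alpha> k + unit_expo i))) = 0"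
      by (simp add: right_diff_distrib sum_distrib_left mult_ac)
    then show ?thesis by (simp add: lin w_def del: shifted_monomial_simps)
  qed
  have pert: "moments (perturb_nu w \<nu> t) (perturb_moments w b t)" for t
    by (rule moments_perturb[OF b _ _ w_step]) (use L(2,3) high in \<open>auto simp: w_def\<close>)
  have "(\<xi>, \<nu>) \<in> deflated_solutions K f N \<alpha> \<delta>" using iso by (simp add: isolated_in_def)
  then have ext: "\<nu> \<in> extensional (mu_index \<alpha> \<delta>)"
    unfolding deflated_solutions_iff[OF K f] by (rule conjunct1)
  have sol: "(\<xi>, perturb_nu w \<nu> t) \<in> deflated_solutions K f N \<alpha> \<delta>" for t
  proof -
    have "nf (perturb_moments w b t) (taylor \<xi> (f k)) l = 0" if "k < N" "l < \<delta>" for k l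
    proof -
      have "nf (perturb_moments w b t) q l = nf b q l + (if l = \<delta> - 1 then t * lincomb id w q else 0)" for q
        by (simp add: nf_def perturb_moments_def lincomb_coeff_add lincomb_coeff_scale lincomb_def[of id "\<lambda>_. 0"])
      moreover have "nf b (taylor \<xi> (f k)) l = 0" using fQ[OF that(1)] sub that(2) by (auto simp: kernel_def)
      ultimately show ?thesis using L(2)[OF fQ[OF that(1)]] by (simp add: L_w)
    qed
    moreover have "perturb_nu w \<nu> t \<in> extensional (mu_index \<alpha> \<delta>)"
      using ext by (auto simp: extensional_def perturb_nu_def)
    ultimately show ?thesis unfolding deflated_solutions_iff[OF K f] using pert by blast
  qed
  obtain T where T: "open T" "T \<inter> deflated_solutions K f N \<alpha> \<delta> = {(\<xi>, \<nu>)}"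
    using iso unfolding isolated_in_def by blast
  let ?U = "(\<lambda>t. (\<xi>, perturb_nu w \<nu> t)) -` T"
  have "open ?U"
    using continuous_on_perturb_nu T(1) by (simp add: continuous_on_open_vimage)
  moreover have "perturb_nu w \<nu> 0 = \<nu>" by (simp add: perturb_nu_def)
  then have "0 \<in> ?U" using T(2) by auto
  \<comment> \<open>An open set of complex numbers that contains 0 has a further element.\<close>
  ultimately obtain t where t: "t \<in> ?U" "t \<noteq> 0"
    by (metis not_open_singleton insertI1 subset_singletonD subsetI empty_iff)
  then have "perturb_nu w \<nu> t = \<nu>" using sol[of t] T(2) by blast
  then have "perturb_moments w b t g (\<delta> - 1) = b g (\<delta> - 1)" for g
    using moments_unique[OF _ b last_index] pert[of t] by simp
  then have "w g = 0" for g using t(2) by (simp add: perturb_moments_def)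
  then show False using L(5) by (simp add: L_w lincomb_def)
qed

end

section \<open>The local component of the ideal\<close>

lemma ideal_max_ideal: "ideal (max_ideal \<xi>) Cx"
  by (rule ideal_mpoly_ringI) (auto simp: max_ideal_def)

lemma ideals_set_simps [simp]:
  "one (ideals_set R) = carrier R" "mult (ideals_set R) = ideal_prod R"
  by (simp_all add: ideals_set_def)

lemma max_ideal_pow_Suc:
  "max_ideal \<xi> [^]\<^bsub>ideals_set Cx\<^esub> Suc k = ideal_prod Cx (max_ideal \<xi> [^]\<^bsub>ideals_set Cx\<^esub> k) (max_ideal \<xi>)"
  by (simp add: nat_pow_def)

lemma ideal_max_ideal_pow: "ideal (max_ideal \<xi> [^]\<^bsub>ideals_set Cx\<^esub> (k::nat)) Cx"
proof -
  interpret cring "Cx :: 'a mpoly ring" by (rule cring_mpoly_ring) simp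
  show ?thesis
  proof (induction k)
    case (Suc k)
    then show ?case
      unfolding max_ideal_pow_Suc by (rule ideal_prod_is_ideal[OF _ ideal_max_ideal])
  qed (use oneideal in simp)
qed

lemma shifted_monomial_in_max_ideal_pow:
  "k \<le> expo_deg g \<Longrightarrow> shifted_monomial \<xi> g \<in> max_ideal \<xi> [^]\<^bsub>ideals_set Cx\<^esub> k"
proof (induction k arbitrary: g)
  case (Suc k)
  then have "g \<noteq> 0" by auto
  then obtain i where "lookup g i \<noteq> 0" by (auto simp: poly_mapping_eq_iff fun_eq_iff)
  then have g: "g = (g - unit_expo i) + unit_expo i"
    using minus_unit_expo_add[of g i "unit_expo i"] by simp
  then have "expo_deg g = expo_deg (g - unit_expo i) + 1"
    by (metis expo_deg_simps(2,3))
  then have "shifted_monomial \<xi> (g - unit_expo i) \<in> max_ideal \<xi> [^]\<^bsub>ideals_set Cx\<^esub> k"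
    using Suc by simp
  moreover have "Var i - Const (\<xi> i) \<in> max_ideal \<xi>" by (simp add: max_ideal_def)
  ultimately have "shifted_monomial \<xi> (g - unit_expo i) \<otimes>\<^bsub>Cx\<^esub> (Var i - Const (\<xi> i)) \<in>
      max_ideal \<xi> [^]\<^bsub>ideals_set Cx\<^esub> Suc k"
    unfolding max_ideal_pow_Suc by (rule ideal_prod.prod)
  then show ?case by (subst g) simp
qed simp

text \<open>A product of elements chosen from the components outside \<open>\<mm>\<^sub>\<xi>\<close>; it does not vanish at \<open>\<xi>\<close> as
  \<open>\<mm>\<^sub>\<xi>\<close> is prime.\<close>

lemma unit_in_other_components:
  assumes fin: "finite P" and P: "\<And>q. q \<in> P \<Longrightarrow> ideal q Cx"
  obtains s where "mpoly_eval \<xi> s \<noteq> 0" "\<And>q. q \<in> P \<Longrightarrow> \<not> q \<subseteq> max_ideal \<xi> \<Longrightarrow> s \<in> q"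
proof -
  have "\<exists>s. mpoly_eval \<xi> s \<noteq> 0 \<and> (\<forall>q\<in>P. \<not> q \<subseteq> max_ideal \<xi> \<longrightarrow> s \<in> q)"
    using fin P
  proof (induction P)
    case empty
    show ?case by (intro exI[of _ 1]) simp
  next
    case (insert q P)
    then obtain s where s: "mpoly_eval \<xi> s \<noteq> 0" "\<forall>q\<in>P. \<not> q \<subseteq> max_ideal \<xi> \<longrightarrow> s \<in> q" by auto
    show ?case
    proof (cases "q \<subseteq> max_ideal \<xi>")
      case False
      then obtain r where r: "r \<in> q" "mpoly_eval \<xi> r \<noteq> 0" by (auto simp: max_ideal_def)
      have "r * s \<in> q'" if "q' \<in> insert q P" "\<not> q' \<subseteq> max_ideal \<xi>" for q'
        using that r s(2) ideal_mpoly_ringD(3)[OF insert.prems, of q' r s]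
          ideal_mpoly_ringD(3)[OF insert.prems, of q' s r]
        by (auto simp: mult.commute)
      then show ?thesis using r s by (intro exI[of _ "r * s"]) auto
    qed (use s in auto)
  qed
  then show ?thesis using that by blast
qed

context lower_exponents
begin

text \<open>Every monomial of a \<open>p\<close> that vanishes at the centre of the expansion raises the degree by at
  least 1.\<close>

lemma nf_raise_degree:
  assumes b: "moments \<nu> b" and p: "lookup p 0 = 0"
    and q: "\<And>k. k < \<delta> \<Longrightarrow> expo_deg (\<alpha> k) < t \<Longrightarrow> nf b q k = 0"
    and l: "l < \<delta>" "expo_deg (\<alpha> l) < Suc t"
  shows "nf b (p * q) l = 0"
proof -
  have "nf b q k * lincomb id (\<lambda>m. b (\<alpha> k + m) l) p = 0" if k: "k < \<delta>" for k
  proof (cases "expo_deg (\<alpha> k) < t")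
    case False
    have "b (\<alpha> k + m) l = 0" if "m \<in> keys p" for m
    proof (rule moments_deg[OF b l(1)])
      have "m \<noteq> 0" using that p by (auto simp: in_keys_iff)
      then have "0 < expo_deg m" by (simp flip: neq0_conv)
      then show "expo_deg (\<alpha> l) < expo_deg (\<alpha> k + m)" using False l(2) by simp
    qed
    then show ?thesis by (simp add: lincomb_def)
  qed (simp add: q[OF k])
  then show ?thesis unfolding nf_mult[OF b l(1)] by (intro sum.neutral) auto
qed

lemma nf_max_ideal_pow:
  assumes b: "moments \<nu> b" and p: "p \<in> max_ideal \<xi> [^]\<^bsub>ideals_set Cx\<^esub> k"
    and l: "l < \<delta>" "expo_deg (\<alpha> l) < k"
  shows "nf b (taylor \<xi> p) l = 0"
  using p l
proof (induction k arbitrary: p l)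
  case (Suc k)
  have "\<forall>l<\<delta>. expo_deg (\<alpha> l) < Suc k \<longrightarrow> nf b (taylor \<xi> p) l = 0"
    using Suc.prems(1) unfolding max_ideal_pow_Suc
  proof (induction p rule: ideal_prod.induct)
    case (prod i j)
    then have "lookup (taylor \<xi> j) 0 = 0" by (simp add: lookup_taylor_0 max_ideal_def)
    from nf_raise_degree[OF b this Suc.IH[OF prod(1)]] show ?case by (simp add: mult.commute)
  qed simp
  then show ?case using Suc.prems by blast
qed simp

lemma max_ideal_pow_le_kernel:
  assumes "moments \<nu> b"
  shows "max_ideal \<xi> [^]\<^bsub>ideals_set Cx\<^esub> (expo_deg (\<alpha> (\<delta> - 1)) + 1) \<subseteq> kernel \<xi> b"
proof
  fix p assume p: "p \<in> max_ideal \<xi> [^]\<^bsub>ideals_set Cx\<^esub> (expo_deg (\<alpha> (\<delta> - 1)) + 1)"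
  have "expo_deg (\<alpha> l) < expo_deg (\<alpha> (\<delta> - 1)) + 1" if "l < \<delta>" for l
    using deg_mono[OF _ last_index, of l] that by (simp add: less_Suc_eq_le)
  then show "p \<in> kernel \<xi> b" using nf_max_ideal_pow[OF assms p] by (simp add: kernel_def)
qed

text \<open>Write \<open>s\<close> as \<open>s(\<xi>)\<close> plus an element of \<open>\<mm>\<^sub>\<xi>\<close>. The latter raises degrees, so the lowest terms of
  the normal forms of \<open>s p\<close> and \<open>s(\<xi>) p\<close> agree.\<close>

lemma kernel_cancel_unit:
  assumes b: "moments \<nu> b" and s: "mpoly_eval \<xi> s \<noteq> 0" and sp: "s * p \<in> kernel \<xi> b"
  shows "p \<in> kernel \<xi> b"
proof -
  let ?c = "mpoly_eval \<xi> s" and ?s = "taylor \<xi> s" and ?p = "taylor \<xi> p"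
  have "nf b ?p l = 0" if "l < \<delta>" "expo_deg (\<alpha> l) < t" for l t
    using that
  proof (induction t arbitrary: l)
    case (Suc t)
    have "nf b ((?s - Const ?c) * ?p) l = 0"
      using Suc by (intro nf_raise_degree[OF b, where t = t])
        (simp_all add: lookup_minus lookup_taylor_0 lookup_Const)
    moreover have "nf b (?s * ?p) l = 0" using sp Suc.prems(1) by (simp add: kernel_def)
    ultimately show ?case using s by (simp add: left_diff_distrib)
  qed simp
  then show ?thesis by (auto simp: kernel_def)
qed

text \<open>If \<open>p\<close> lies in the components contained in \<open>\<mm>\<^sub>\<xi>\<close>, then \<open>s p \<in> J\<close> for some \<open>s\<close> that does not vanish
  at \<open>\<xi>\<close>.\<close>

lemma component_le_kernel:
  assumes b: "moments \<nu> b" and P: "minimal_primary_decomposition Cx J P" and J: "J \<subseteq> kernel \<xi> b"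
  shows "component_at \<xi> P \<subseteq> kernel \<xi> b"
proof
  fix p assume p: "p \<in> component_at \<xi> P"
  have ideals: "ideal q Cx" if "q \<in> P" for q
    using P that by (simp add: minimal_primary_decomposition_def primary_ideal_def)
  obtain s where s: "mpoly_eval \<xi> s \<noteq> 0" "\<And>q. q \<in> P \<Longrightarrow> \<not> q \<subseteq> max_ideal \<xi> \<Longrightarrow> s \<in> q"
    using unit_in_other_components[of P \<xi>] P ideals unfolding minimal_primary_decomposition_def by blast
  have "s * p \<in> q" if "q \<in> P" for q
  proof (cases "q \<subseteq> max_ideal \<xi>")
    case True
    then have "p \<in> q" using p that by (auto simp: component_at_def)
    then show ?thesis using ideal_mpoly_ringD(3)[OF ideals[OF that]] by simp
  next
    case False
    then show ?thesis using s(2)[OF that] ideal_mpoly_ringD(3)[OF ideals[OF that], of s p]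
      by (simp add: mult.commute)
  qed
  then have "s * p \<in> J" using P by (auto simp: minimal_primary_decomposition_def)
  then show "p \<in> kernel \<xi> b" using kernel_cancel_unit[OF b s(1)] J by blast
qed

lemma ideal_component_at:
  assumes "minimal_primary_decomposition Cx J P"
  shows "ideal (component_at \<xi> P) Cx"
proof -
  have "ideal q Cx" if "q \<in> P" for q
    using assms that by (simp add: minimal_primary_decomposition_def primary_ideal_def)
  note D = ideal_mpoly_ringD(1-3)[OF this]
  show ?thesis
    by (intro ideal_mpoly_ringI) (auto simp: component_at_def D)
qed

text \<open>The ideal on the left contains the \<open>f\<^sub>k\<close> and all shifted monomials of degree above \<open>|\<alpha>|\<close> for the
  last exponent \<open>\<alpha>\<close>, and it is contained in the kernel; for isolated solutions no such ideal is
  strictly smaller than the kernel.\<close>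

theorem kernel_eq_local_component:
  assumes K: "subfield K complex_ring" and f: "f ` {..<N} \<subseteq> carrier (mpoly_ring K UNIV)"
    and iso: "(\<xi>, \<nu>) isolated_in deflated_solutions K f N \<alpha> \<delta>"
    and b: "moments \<nu> b"
    and P: "minimal_primary_decomposition Cx J P" and J: "J \<subseteq> kernel \<xi> b"
    and fJ: "\<And>k. k < N \<Longrightarrow> f k \<in> J"
  shows "component_at \<xi> P <+>\<^bsub>Cx\<^esub> (max_ideal \<xi> [^]\<^bsub>ideals_set Cx\<^esub> (expo_deg (\<alpha> (\<delta> - 1)) + 1)) = kernel \<xi> b"
    (is "?I <+>\<^bsub>Cx\<^esub> ?m = _")
proof
  interpret cring "Cx :: 'n mpoly ring" by (rule cring_mpoly_ring) simp
  have Q: "ideal (?I <+>\<^bsub>Cx\<^esub> ?m) Cx"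
    by (intro add_ideals ideal_component_at[OF P] ideal_max_ideal_pow)
  have mem: "p + q \<in> ?I <+>\<^bsub>Cx\<^esub> ?m" if "p \<in> ?I" "q \<in> ?m" for p q
    using that by (auto simp: set_add_def')
  show sub: "?I <+>\<^bsub>Cx\<^esub> ?m \<subseteq> kernel \<xi> b"
  proof
    fix r assume "r \<in> ?I <+>\<^bsub>Cx\<^esub> ?m"
    then obtain p q where "p \<in> ?I" "q \<in> ?m" "r = p + q" by (auto simp: set_add_def')
    then show "r \<in> kernel \<xi> b"
      using component_le_kernel[OF b P J] max_ideal_pow_le_kernel[OF b]
        ideal_mpoly_ringD(2)[OF ideal_kernel[OF b]] by blast
  qed
  show "kernel \<xi> b \<subseteq> ?I <+>\<^bsub>Cx\<^esub> ?m"
  proof (rule isolated_imp_kernel_subset[OF K f iso b Q _ sub])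
    fix k assume "k < N"
    then have "f k \<in> ?I"
      using fJ P unfolding minimal_primary_decomposition_def component_at_def by blast
    from mem[OF this ideal_mpoly_ringD(1)[OF ideal_max_ideal_pow]]
    show "f k \<in> ?I <+>\<^bsub>Cx\<^esub> ?m" by (simp only: add_0_right)
  next
    fix g :: "'n expo" assume "expo_deg (\<alpha> (\<delta> - 1)) < expo_deg g"
    then have "shifted_monomial \<xi> g \<in> ?m" by (intro shifted_monomial_in_max_ideal_pow) simp
    from mem[OF ideal_mpoly_ringD(1)[OF ideal_component_at[OF P]] this]
    show "shifted_monomial \<xi> g \<in> ?I <+>\<^bsub>Cx\<^esub> ?m" by (simp only: add_0_left)
  qed
qed

end

theorem theorem4p17:
  fixes K :: "complex set"
    and f :: "nat \<Rightarrow> 'n::{finite,linorder} mpoly" and N :: nat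
    and I :: "'n mpoly set"
    and \<alpha> :: "nat \<Rightarrow> 'n expo" and \<delta> d :: nat
    and \<xi> :: "'n \<Rightarrow> complex" and \<nu> :: "'n expo \<times> 'n expo \<Rightarrow> complex"
  assumes "subfield K complex_ring"
    and "\<And>k. k < N \<Longrightarrow> f k \<in> carrier (mpoly_ring K UNIV)"
    and "I = genideal (mpoly_ring K UNIV) (f ` {..<N})"
    and "0 < \<delta>" and "inj_on \<alpha> {..<\<delta>}"
    and "stable_under_subtraction (exponents \<alpha> \<delta>)"
    and "\<alpha> 0 = 0"
    and "\<And>i j. i \<le> j \<Longrightarrow> j < \<delta> \<Longrightarrow> expo_deg (\<alpha> i) \<le> expo_deg (\<alpha> j)"
    and "d = expo_deg (\<alpha> (\<delta> - 1))"
    and "(\<xi>, \<nu>) isolated_in deflated_solutions K f N \<alpha> \<delta>"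
  shows "(\<forall>p\<in>I. mpoly_eval \<xi> p = 0) \<and>
    (\<exists>\<Lambda>.
      (\<exists>Q. ideal Q Cx \<and> primal_dual_basis_pair \<xi> \<alpha> \<delta> Q \<Lambda>) \<and>
      (\<forall>i<\<delta>. \<forall>b. (\<alpha> i, b) \<in> mu_index \<alpha> \<delta> \<longrightarrow> nu_coeff (\<Lambda> i) b = \<nu> (\<alpha> i, b)) \<and>
      (\<forall>Q \<Lambda>'. ideal Q Cx \<and> primal_dual_basis_pair \<xi> \<alpha> \<delta> Q \<Lambda>' \<and>
         (\<forall>i<\<delta>. \<forall>b. (\<alpha> i, b) \<in> mu_index \<alpha> \<delta> \<longrightarrow> nu_coeff (\<Lambda>' i) b = \<nu> (\<alpha> i, b)) \<longrightarrow>
         (\<forall>i<\<delta>. \<Lambda>' i = \<Lambda> i)) \<and>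
      (\<forall>P. minimal_primary_decomposition Cx (genideal Cx I) P \<longrightarrow>
         primal_dual_basis_pair \<xi> \<alpha> \<delta>
           (component_at \<xi> P <+>\<^bsub>Cx\<^esub> (max_ideal \<xi> [^]\<^bsub>ideals_set Cx\<^esub> (d + 1))) \<Lambda>))"
proof -
  note K = assms(1)
  have f: "f ` {..<N} \<subseteq> carrier (mpoly_ring K UNIV)" using assms(2) by auto
  interpret lower_exponents \<alpha> \<delta> by unfold_locales (use assms in auto)
  have "(\<xi>, \<nu>) \<in> deflated_solutions K f N \<alpha> \<delta>" using assms(10) by (simp add: isolated_in_def)
  then obtain b where b: "moments \<nu> b" and fb: "\<And>k l. k < N \<Longrightarrow> l < \<delta> \<Longrightarrow> nf b (taylor \<xi> (f k)) l = 0"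
    unfolding deflated_solutions_iff[OF K f] by blast
  have K': "subring_set K" by (rule subring_set_subfield[OF K])
  have I_kernel: "I \<subseteq> kernel \<xi> b"
  proof -
    let ?R = "mpoly_ring K (UNIV :: 'n set)"
    have "ideal (kernel \<xi> b \<inter> carrier ?R) ?R"
      using ideal_mpoly_ringD(1-3)[OF ideal_kernel[OF b, of \<xi>]]
        subring_setD[OF subring_set_mpoly_ring[OF K', of UNIV]]
      by (intro ideal_mpoly_ringI[OF K']) auto
    moreover have "f ` {..<N} \<subseteq> kernel \<xi> b \<inter> carrier ?R"
      using f fb by (auto simp: kernel_def)
    ultimately show ?thesis unfolding assms(3) using genideal_leI by blast
  qed
  have root: "mpoly_eval \<xi> p = 0" if "p \<in> kernel \<xi> b" for p
    using that pos nf_row_0[OF b, of "taylor \<xi> p"] by (auto simp: kernel_def lookup_taylor_0)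
  have coeff: "nu_coeff (dual_fun b i) g = \<nu> (\<alpha> i, g)" if i: "i < \<delta>" and g: "(\<alpha> i, g) \<in> mu_index \<alpha> \<delta>" for i g
  proof -
    obtain k j where k: "k < \<delta>" "g = \<alpha> k + unit_expo j" "g \<notin> exponents \<alpha> \<delta>"
      "expo_deg (\<alpha> k) + 1 \<le> expo_deg (\<alpha> i)"
      using g by (auto simp: mu_index_def)
    then have "\<alpha> i \<noteq> g" using i by (metis imageI lessThan_iff)
    then show ?thesis using k moments_mat_entry[OF b k(1) i] by (simp add: nu_coeff_dual_fun[OF b i] mat_entry_def)
  qed
  have unique: "L i = dual_fun b i"
    if "ideal Q Cx" "primal_dual_basis_pair \<xi> \<alpha> \<delta> Q L" "i < \<delta>"
      "\<forall>i<\<delta>. \<forall>g. (\<alpha> i, g) \<in> mu_index \<alpha> \<delta> \<longrightarrow> nu_coeff (L i) g = \<nu> (\<alpha> i, g)" for Q L i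
  proof (rule dfun_eqI)
    fix g
    have "moments \<nu> (\<lambda>g l. nu_coeff (L l) g)"
      using that by (intro primal_dual_basis_pair_moments) auto
    from moments_unique[OF this b \<open>i < \<delta>\<close>] show "nu_coeff (L i) g = nu_coeff (dual_fun b i) g"
      by (simp add: nu_coeff_dual_fun[OF b \<open>i < \<delta>\<close>])
  qed
  have local_component: "component_at \<xi> P <+>\<^bsub>Cx\<^esub> (max_ideal \<xi> [^]\<^bsub>ideals_set Cx\<^esub> (d + 1)) = kernel \<xi> b"
    if "minimal_primary_decomposition Cx (genideal Cx I) P" for P
    unfolding assms(9)
  proof (rule kernel_eq_local_component[OF K f assms(10) b that])
    show "genideal Cx I \<subseteq> kernel \<xi> b" by (intro genideal_leI ideal_kernel[OF b] I_kernel)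
    show "f k \<in> genideal Cx I" if "k < N" for k
      using that subset_genideal[of "f ` {..<N}"] subset_genideal[of I] unfolding assms(3) by blast
  qed
  note pair = primal_dual_basis_pair_kernel[OF b, of \<xi>]
  show ?thesis
  proof (intro conjI exI[of _ "dual_fun b"] allI impI ballI)
    show "mpoly_eval \<xi> p = 0" if "p \<in> I" for p using that I_kernel root by blast
    show "\<exists>Q. ideal Q Cx \<and> primal_dual_basis_pair \<xi> \<alpha> \<delta> Q (dual_fun b)"
      using ideal_kernel[OF b] pair by blast
    show "nu_coeff (dual_fun b i) g = \<nu> (\<alpha> i, g)" if "i < \<delta>" "(\<alpha> i, g) \<in> mu_index \<alpha> \<delta>" for i g
      by (rule coeff[OF that])
    show "L i = dual_fun b i"
      if "ideal Q Cx \<and> primal_dual_basis_pair \<xi> \<alpha> \<delta> Q L \<and>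
         (\<forall>i<\<delta>. \<forall>b. (\<alpha> i, b) \<in> mu_index \<alpha> \<delta> \<longrightarrow> nu_coeff (L i) b = \<nu> (\<alpha> i, b))" "i < \<delta>" for Q L i
      using that unique by blast
    show "primal_dual_basis_pair \<xi> \<alpha> \<delta>
        (component_at \<xi> P <+>\<^bsub>Cx\<^esub> (max_ideal \<xi> [^]\<^bsub>ideals_set Cx\<^esub> (d + 1))) (dual_fun b)"
      if "minimal_primary_decomposition Cx (genideal Cx I) P" for P
      unfolding local_component[OF that] by (rule pair)
  qed
qed

end
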